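(* Let $R$ be a noetherian ring, $I$ an ideal of $R$, $M$ a finitely generated $R$-module, and $f\in I^s\setminus I^{s+1}$. The following two conditions are equivalent: $( * )$ multiplication by $f$ from $M/\Gamma_I(M)$ to $M/\Gamma_I(M)$ is injective; $( ** )$ the section $\alpha_s(ft^s)$ is $\mathcal{B}(M)$-regular on the blowup scheme $S_I$.
   Context: $\Gamma_I(M)=\bigcup_{n\in\mathbb{N}}(0:_M I^n)$, where $(0:_M J)=\{m\in M: Jm=0\}$ for an ideal $J$. $B(R)=R[It]=\bigoplus_{n\ge 0} I^nt^n$ (with $I^0=R$), graded by powers of $t$; $S_I=\operatorname{Proj} B(R)$ is the blowup of $I$ in $\operatorname{Spec} R$. $\mathcal{B}(M)$ is the $\mathcal{O}_{S_I}$-module associated to the graded module $B(M)=\bigoplus_{n\ge 0} I^nM\,t^n$. The section $\alpha_s(ft^s)\in\Gamma(S_I,\mathcal{O}_{S_I}(s))$ is the global section which in each standard chart is $ft^s/1$; if $h_0,\dots,h_r$ generate $I$, it is $(f/h_i^s)\,(h_it)^s$ on $D_+(h_it)\cong\operatorname{Spec}R[I/h_i]$. A section $\sigma\in\Gamma(X,\mathcal{O}_X(s))$ is called $\mathcal{M}$-regular, for an $\mathcal{O}_X$-module $\mathcal{M}$, if the multiplication map $\mathcal{M}\to\mathcal{M}(s)$ by $\sigma$ is injective. *)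

theory Defs
  imports Complex_Main
    "HOL-Computational_Algebra.Polynomial"
    "HOL-Algebra.Free_Abelian_Groups"
    "HOL-Analysis.Abstract_Topology"
begin

section \<open>Ideals and torsion\<close>

text \<open>
  Rings are types of class \<open>comm_ring_1\<close>; a module is a type \<open>'b\<close> with a scalar multiplication
  satisfying the library locale \<open>module\<close>. Ideals are the subspaces of \<open>('a, (*))\<close>.
\<close>

abbreviation is_ideal :: "'a::comm_ring_1 set \<Rightarrow> bool"
  where "is_ideal \<equiv> module.subspace (*)"

definition noetherian_type :: "'a::comm_ring_1 itself \<Rightarrow> bool"
  where "noetherian_type _ \<longleftrightarrow>
    (\<forall>J::'a set. is_ideal J \<longrightarrow> (\<exists>A. finite A \<and> module.span (*) A = J))"

definition finitely_generated :: "('a::comm_ring_1 \<Rightarrow> 'b::ab_group_add \<Rightarrow> 'b) \<Rightarrow> bool"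
  where "finitely_generated scale \<longleftrightarrow> (\<exists>A. finite A \<and> module.span scale A = UNIV)"

definition ideal_times ::
    "('a::comm_ring_1 \<Rightarrow> 'b::ab_group_add \<Rightarrow> 'b) \<Rightarrow> 'a set \<Rightarrow> 'b set \<Rightarrow> 'b set"
  where "ideal_times scale J N = module.span scale {scale a m | a m. a \<in> J \<and> m \<in> N}"

primrec ideal_power :: "'a::comm_ring_1 set \<Rightarrow> nat \<Rightarrow> 'a set"
  where
    "ideal_power I 0 = UNIV"
  | "ideal_power I (Suc n) = ideal_times (*) I (ideal_power I n)"

definition annihilated_by ::
    "('a::comm_ring_1 \<Rightarrow> 'b::ab_group_add \<Rightarrow> 'b) \<Rightarrow> 'a set \<Rightarrow> 'b set"
  where "annihilated_by scale J = {m. \<forall>a\<in>J. scale a m = 0}"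

definition torsion ::
    "('a::comm_ring_1 \<Rightarrow> 'b::ab_group_add \<Rightarrow> 'b) \<Rightarrow> 'a set \<Rightarrow> 'b set"
  where "torsion scale I = (\<Union>n. annihilated_by scale (ideal_power I n))"

definition mod_rel :: "'b::ab_group_add set \<Rightarrow> ('b \<times> 'b) set"
  where "mod_rel N = {(m, m'). m - m' \<in> N}"

definition quotient_mult ::
    "('a::comm_ring_1 \<Rightarrow> 'b::ab_group_add \<Rightarrow> 'b) \<Rightarrow> 'b set \<Rightarrow> 'a \<Rightarrow> 'b set \<Rightarrow> 'b set"
  where "quotient_mult scale N f C = (\<Union>m\<in>C. mod_rel N `` {scale f m})"


section \<open>Proj of a graded ring\<close>

text \<open>
  A graded ring is given by its homogeneous components \<open>S n\<close>, subgroups of an ambient ring; the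
  ring itself is their internal direct sum \<open>graded_total S\<close>, in general not the whole type. Graded
  modules are given in the same way by components \<open>N n\<close>.
\<close>

definition graded_total :: "(nat \<Rightarrow> 'r::comm_monoid_add set) \<Rightarrow> 'r set"
  where "graded_total S = {\<Sum>n\<le>k. g n | g k. \<forall>n. g n \<in> S n}"

definition homogeneous_prime :: "(nat \<Rightarrow> 'r::comm_ring_1 set) \<Rightarrow> 'r set \<Rightarrow> bool"
  where "homogeneous_prime S p \<longleftrightarrow>
    p \<subseteq> graded_total S \<and>
    0 \<in> p \<and> (\<forall>a\<in>p. \<forall>b\<in>p. a + b \<in> p) \<and> (\<forall>a\<in>graded_total S. \<forall>b\<in>p. a * b \<in> p) \<and>
    (\<forall>a\<in>p. \<exists>g k. (\<forall>n. g n \<in> S n \<inter> p) \<and> a = (\<Sum>n\<le>k. g n)) \<and>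
    1 \<notin> p \<and>
    (\<forall>a\<in>graded_total S. \<forall>b\<in>graded_total S. a * b \<in> p \<longrightarrow> a \<in> p \<or> b \<in> p)"

definition Proj_points :: "(nat \<Rightarrow> 'r::comm_ring_1 set) \<Rightarrow> 'r set set"
  where "Proj_points S = {p. homogeneous_prime S p \<and> \<not> (\<forall>n>0. S n \<subseteq> p)}"

text \<open>The closed sets are the sets \<open>V(E)\<close>, for sets \<open>E\<close> of homogeneous elements.\<close>

definition Proj_open :: "(nat \<Rightarrow> 'r::comm_ring_1 set) \<Rightarrow> 'r set set \<Rightarrow> bool"
  where "Proj_open S U \<longleftrightarrow> (\<exists>E. E \<subseteq> (\<Union>n. S n) \<and> U = {p \<in> Proj_points S. \<not> E \<subseteq> p})"

definition Proj_topology :: "(nat \<Rightarrow> 'r::comm_ring_1 set) \<Rightarrow> 'r set topology"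
  where "Proj_topology S = topology (Proj_open S)"

lemma homogeneous_in_total:
  assumes z: "\<And>n. 0 \<in> S n" and a: "a \<in> S n"
  shows "a \<in> graded_total S"
proof -
  have "a = (\<Sum>i\<le>n. if i = n then a else 0)" by simp
  moreover have "\<forall>i. (if i = n then a else 0) \<in> S i" using z a by auto
  ultimately show ?thesis
    unfolding graded_total_def by blast
qed

lemma openin_Proj_topology:
  assumes z: "\<And>n. 0 \<in> S n"
    and mult: "\<And>m n a b. a \<in> S m \<Longrightarrow> b \<in> S n \<Longrightarrow> a * b \<in> S (m + n)"
  shows "openin (Proj_topology S) = Proj_open S"
proof -
  have "istopology (Proj_open S)"
    unfolding istopology_def
  proof (intro conjI allI impI)
    fix U V assume "Proj_open S U" "Proj_open S V"
    then obtain E F where E: "E \<subseteq> (\<Union>n. S n)" "U = {p \<in> Proj_points S. \<not> E \<subseteq> p}"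
      and F: "F \<subseteq> (\<Union>n. S n)" "V = {p \<in> Proj_points S. \<not> F \<subseteq> p}"
      unfolding Proj_open_def by auto
    let ?G = "{a * b | a b. a \<in> E \<and> b \<in> F}"
    have "?G \<subseteq> (\<Union>n. S n)" using E(1) F(1) mult by fastforce
    moreover have "U \<inter> V = {p \<in> Proj_points S. \<not> ?G \<subseteq> p}"
    proof (intro Set.set_eqI iffI)
      fix p assume "p \<in> U \<inter> V"
      then obtain a b where p: "p \<in> Proj_points S" and ab: "a \<in> E" "a \<notin> p" "b \<in> F" "b \<notin> p"
        using E F by auto
      have "a \<in> graded_total S" "b \<in> graded_total S"
        using ab E(1) F(1) homogeneous_in_total[of S, OF z] by blast+
      then have "a * b \<notin> p" using p ab unfolding Proj_points_def homogeneous_prime_def by blast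
      then show "p \<in> {p \<in> Proj_points S. \<not> ?G \<subseteq> p}" using p ab by blast
    next
      fix p assume "p \<in> {p \<in> Proj_points S. \<not> ?G \<subseteq> p}"
      then obtain a b where p: "p \<in> Proj_points S" and ab: "a \<in> E" "b \<in> F" "a * b \<notin> p" by auto
      have t: "a \<in> graded_total S" "b \<in> graded_total S"
        using ab E(1) F(1) homogeneous_in_total[of S, OF z] by blast+
      have cl: "u * v \<in> p" if "u \<in> graded_total S" "v \<in> p" for u v
        using p that unfolding Proj_points_def homogeneous_prime_def by blast
      have "b \<notin> p" using cl[OF t(1)] ab(3) by blast
      moreover have "a \<notin> p" using cl[OF t(2), of a] ab(3) by (auto simp: mult.commute)
      ultimately have "a \<notin> p" "b \<notin> p" by simp_all
      then show "p \<in> U \<inter> V" using p ab E F by auto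
    qed
    ultimately show "Proj_open S (U \<inter> V)" unfolding Proj_open_def by blast
  next
    fix K assume "\<forall>U\<in>K. Proj_open S U"
    then obtain E where E: "\<And>U. U \<in> K \<Longrightarrow> E U \<subseteq> (\<Union>n. S n) \<and> U = {p \<in> Proj_points S. \<not> E U \<subseteq> p}"
      unfolding Proj_open_def by metis
    have "\<Union>K = {p \<in> Proj_points S. \<not> (\<Union>U\<in>K. E U) \<subseteq> p}" using E by blast
    moreover have "(\<Union>U\<in>K. E U) \<subseteq> (\<Union>n. S n)" using E by blast
    ultimately show "Proj_open S (\<Union>K)" unfolding Proj_open_def by blast
  qed
  then show ?thesis unfolding Proj_topology_def by simp
qed


section \<open>Sheaves of modules\<close>

text \<open>
  A sheaf is represented by its sections, viewed as extensional functions into stalks, so that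
  restriction of sections is restriction of functions; the module operations act pointwise. A
  structure sheaf is a sheaf of modules over itself.
\<close>

record ('p, 'c, 'v) module_sheaf =
  sections :: "'p set \<Rightarrow> ('p \<Rightarrow> 'v) set"
  stalk_add :: "'p \<Rightarrow> 'v \<Rightarrow> 'v \<Rightarrow> 'v"
  stalk_smult :: "'p \<Rightarrow> 'c \<Rightarrow> 'v \<Rightarrow> 'v"

definition section_add ::
    "('p, 'c, 'v) module_sheaf \<Rightarrow> 'p set \<Rightarrow> ('p \<Rightarrow> 'v) \<Rightarrow> ('p \<Rightarrow> 'v) \<Rightarrow> 'p \<Rightarrow> 'v"
  where "section_add \<F> U a b = (\<lambda>x\<in>U. stalk_add \<F> x (a x) (b x))"

definition section_smult ::
    "('p, 'c, 'v) module_sheaf \<Rightarrow> 'p set \<Rightarrow> ('p \<Rightarrow> 'c) \<Rightarrow> ('p \<Rightarrow> 'v) \<Rightarrow> 'p \<Rightarrow> 'v"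
  where "section_smult \<F> U r a = (\<lambda>x\<in>U. stalk_smult \<F> x (r x) (a x))"

subsection \<open>Tensor products\<close>

text \<open>
  The tensor product of \<open>\<F>\<close> and \<open>\<G>\<close> over \<open>\<O>\<close> is the sheafification of
  \<open>U \<mapsto> \<F>(U) \<otimes> \<G>(U)\<close> over \<open>\<O>(U)\<close>, where the tensor product of modules is the free abelian group
  on pairs modulo the bilinear relations.
\<close>

definition tensor_relations ::
    "('p, 'c, 'c) module_sheaf \<Rightarrow> ('p, 'c, 'v) module_sheaf \<Rightarrow> ('p, 'c, 'w) module_sheaf \<Rightarrow> 'p set
      \<Rightarrow> (('p \<Rightarrow> 'v) \<times> ('p \<Rightarrow> 'w) \<Rightarrow>\<^sub>0 int) set"
  where "tensor_relations \<O> \<F> \<G> U =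
    {frag_of (section_add \<F> U a a', b) - frag_of (a, b) - frag_of (a', b) | a a' b.
       a \<in> sections \<F> U \<and> a' \<in> sections \<F> U \<and> b \<in> sections \<G> U} \<union>
    {frag_of (a, section_add \<G> U b b') - frag_of (a, b) - frag_of (a, b') | a b b'.
       a \<in> sections \<F> U \<and> b \<in> sections \<G> U \<and> b' \<in> sections \<G> U} \<union>
    {frag_of (section_smult \<F> U r a, b) - frag_of (a, section_smult \<G> U r b) | r a b.
       r \<in> sections \<O> U \<and> a \<in> sections \<F> U \<and> b \<in> sections \<G> U}"

abbreviation tensor_free ::
    "('p, 'c, 'v) module_sheaf \<Rightarrow> ('p, 'c, 'w) module_sheaf \<Rightarrow> 'p set
      \<Rightarrow> (('p \<Rightarrow> 'v) \<times> ('p \<Rightarrow> 'w) \<Rightarrow>\<^sub>0 int) monoid"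
  where "tensor_free \<F> \<G> U \<equiv> free_Abelian_group (sections \<F> U \<times> sections \<G> U)"

definition tensor_kernel ::
    "('p, 'c, 'c) module_sheaf \<Rightarrow> ('p, 'c, 'v) module_sheaf \<Rightarrow> ('p, 'c, 'w) module_sheaf \<Rightarrow> 'p set
      \<Rightarrow> (('p \<Rightarrow> 'v) \<times> ('p \<Rightarrow> 'w) \<Rightarrow>\<^sub>0 int) set"
  where "tensor_kernel \<O> \<F> \<G> U = generate (tensor_free \<F> \<G> U) (tensor_relations \<O> \<F> \<G> U)"

definition tensor_presheaf ::
    "('p, 'c, 'c) module_sheaf \<Rightarrow> ('p, 'c, 'v) module_sheaf \<Rightarrow> ('p, 'c, 'w) module_sheaf \<Rightarrow> 'p set
      \<Rightarrow> (('p \<Rightarrow> 'v) \<times> ('p \<Rightarrow> 'w) \<Rightarrow>\<^sub>0 int) set monoid"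
  where "tensor_presheaf \<O> \<F> \<G> U = tensor_free \<F> \<G> U Mod tensor_kernel \<O> \<F> \<G> U"

definition tensor_class ::
    "('p, 'c, 'c) module_sheaf \<Rightarrow> ('p, 'c, 'v) module_sheaf \<Rightarrow> ('p, 'c, 'w) module_sheaf \<Rightarrow> 'p set
      \<Rightarrow> (('p \<Rightarrow> 'v) \<times> ('p \<Rightarrow> 'w) \<Rightarrow>\<^sub>0 int) \<Rightarrow> (('p \<Rightarrow> 'v) \<times> ('p \<Rightarrow> 'w) \<Rightarrow>\<^sub>0 int) set"
  where "tensor_class \<O> \<F> \<G> U c = tensor_kernel \<O> \<F> \<G> U #>\<^bsub>tensor_free \<F> \<G> U\<^esub> c"

definition tensor_restrict ::
    "('p, 'c, 'c) module_sheaf \<Rightarrow> ('p, 'c, 'v) module_sheaf \<Rightarrow> ('p, 'c, 'w) module_sheaf \<Rightarrow> 'p set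
      \<Rightarrow> (('p \<Rightarrow> 'v) \<times> ('p \<Rightarrow> 'w) \<Rightarrow>\<^sub>0 int) set \<Rightarrow> (('p \<Rightarrow> 'v) \<times> ('p \<Rightarrow> 'w) \<Rightarrow>\<^sub>0 int) set"
  where "tensor_restrict \<O> \<F> \<G> V t =
    (\<Union>c\<in>t. tensor_class \<O> \<F> \<G> V
       (frag_extend (\<lambda>(a, b). frag_of (restrict a V, restrict b V)) c))"

text \<open>
  For a presheaf \<open>P\<close> with restrictions \<open>res V : P(U) \<rightarrow> P(V)\<close>, \<open>germ X P res x (U, t)\<close> is the
  equivalence class of \<open>(U, t)\<close> in the stalk at \<open>x\<close>, and sections of the sheafification are the
  functions into stalks that are locally given by sections of \<open>P\<close>.
\<close>

definition germ ::
    "'p topology \<Rightarrow> ('p set \<Rightarrow> 't set) \<Rightarrow> ('p set \<Rightarrow> 't \<Rightarrow> 't) \<Rightarrow> 'p \<Rightarrow> 'p set \<times> 't \<Rightarrow> ('p set \<times> 't) set"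
  where "germ X P res x = (\<lambda>(U, t). {(W, t'). openin X W \<and> x \<in> W \<and> t' \<in> P W \<and>
     (\<exists>Z. openin X Z \<and> x \<in> Z \<and> Z \<subseteq> U \<inter> W \<and> res Z t = res Z t')})"

definition sheafification ::
    "'p topology \<Rightarrow> ('p set \<Rightarrow> 't set) \<Rightarrow> ('p set \<Rightarrow> 't \<Rightarrow> 't) \<Rightarrow> 'p set
      \<Rightarrow> ('p \<Rightarrow> ('p set \<times> 't) set) set"
  where "sheafification X P res U = {s \<in> extensional U.
     \<forall>x\<in>U. \<exists>V t. openin X V \<and> x \<in> V \<and> V \<subseteq> U \<and> t \<in> P V \<and> (\<forall>y\<in>V. s y = germ X P res y (V, t))}"

definition tensor_sheaf ::
    "'p topology \<Rightarrow> ('p, 'c, 'c) module_sheaf \<Rightarrow> ('p, 'c, 'v) module_sheaf \<Rightarrow>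
      ('p, 'c, 'w) module_sheaf \<Rightarrow> 'p set
      \<Rightarrow> ('p \<Rightarrow> ('p set \<times> (('p \<Rightarrow> 'v) \<times> ('p \<Rightarrow> 'w) \<Rightarrow>\<^sub>0 int) set) set) set"
  where "tensor_sheaf X \<O> \<F> \<G> =
    sheafification X (\<lambda>U. carrier (tensor_presheaf \<O> \<F> \<G> U)) (tensor_restrict \<O> \<F> \<G>)"

text \<open>
  Multiplication by a global section \<open>\<sigma>\<close> of \<open>\<L>\<close>, as a map from \<open>\<F>\<close> to the tensor product of \<open>\<F>\<close>
  and \<open>\<L>\<close>, on sections over \<open>U\<close>: \<open>a\<close> is sent to the section defined by the pure tensor of \<open>a\<close> and
  the restriction of \<open>\<sigma>\<close> to \<open>U\<close>.
\<close>

definition mult_section ::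
    "'p topology \<Rightarrow> ('p, 'c, 'c) module_sheaf \<Rightarrow> ('p, 'c, 'v) module_sheaf \<Rightarrow>
      ('p, 'c, 'w) module_sheaf \<Rightarrow> ('p \<Rightarrow> 'w) \<Rightarrow> 'p set \<Rightarrow> ('p \<Rightarrow> 'v)
      \<Rightarrow> ('p \<Rightarrow> ('p set \<times> (('p \<Rightarrow> 'v) \<times> ('p \<Rightarrow> 'w) \<Rightarrow>\<^sub>0 int) set) set)"
  where "mult_section X \<O> \<F> \<L> \<sigma> U a =
    (\<lambda>x\<in>U. germ X (\<lambda>U. carrier (tensor_presheaf \<O> \<F> \<L> U)) (tensor_restrict \<O> \<F> \<L>) x
       (U, tensor_class \<O> \<F> \<L> U (frag_of (a, restrict \<sigma> U))))"

lemma mult_section_in_tensor_sheaf: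
  assumes "openin X U" "a \<in> sections \<F> U" "restrict \<sigma> U \<in> sections \<L> U"
  shows "mult_section X \<O> \<F> \<L> \<sigma> U a \<in> tensor_sheaf X \<O> \<F> \<L> U"
proof -
  let ?t = "tensor_class \<O> \<F> \<L> U (frag_of (a, restrict \<sigma> U))"
  have "frag_of (a, restrict \<sigma> U) \<in> carrier (tensor_free \<F> \<L> U)"
    using assms by simp
  then have "?t \<in> carrier (tensor_presheaf \<O> \<F> \<L> U)"
    unfolding tensor_class_def tensor_presheaf_def FactGroup_def RCOSETS_def by auto
  then show ?thesis
    using assms(1) unfolding tensor_sheaf_def sheafification_def mult_section_def
    by (auto intro!: exI[of _ U] exI[of _ ?t])
qed

definition regular_section ::
    "'p topology \<Rightarrow> ('p, 'c, 'c) module_sheaf \<Rightarrow> ('p, 'c, 'v) module_sheaf \<Rightarrow>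
      ('p, 'c, 'w) module_sheaf \<Rightarrow> ('p \<Rightarrow> 'w) \<Rightarrow> bool"
  where "regular_section X \<O> \<F> \<L> \<sigma> \<longleftrightarrow>
    (\<forall>U. openin X U \<longrightarrow> inj_on (mult_section X \<O> \<F> \<L> \<sigma> U) (sections \<F> U))"


section \<open>The sheaf associated to a graded module\<close>

text \<open>
  The stalk at \<open>p\<close> is the degree zero part of the localization of \<open>N\<close> at the homogeneous elements
  outside \<open>p\<close>; \<open>act\<close> is the scalar multiplication of the ambient ring on the ambient module.
\<close>

definition homogeneous_fractions ::
    "(nat \<Rightarrow> 'r set) \<Rightarrow> (nat \<Rightarrow> 'n set) \<Rightarrow> 'r set \<Rightarrow> ('n \<times> 'r) set"
  where "homogeneous_fractions S N p = {(m, x). \<exists>n. m \<in> N n \<and> x \<in> S n \<and> x \<notin> p}"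

definition fraction_rel ::
    "(nat \<Rightarrow> 'r::comm_ring_1 set) \<Rightarrow> ('r \<Rightarrow> 'n::ab_group_add \<Rightarrow> 'n) \<Rightarrow> (nat \<Rightarrow> 'n set) \<Rightarrow> 'r set
      \<Rightarrow> (('n \<times> 'r) \<times> ('n \<times> 'r)) set"
  where "fraction_rel S act N p = {((m, x), (m', x')).
     (m, x) \<in> homogeneous_fractions S N p \<and> (m', x') \<in> homogeneous_fractions S N p \<and>
     (\<exists>k. \<exists>u \<in> S k - p. act u (act x' m - act x m') = 0)}"

definition fraction ::
    "(nat \<Rightarrow> 'r::comm_ring_1 set) \<Rightarrow> ('r \<Rightarrow> 'n::ab_group_add \<Rightarrow> 'n) \<Rightarrow> (nat \<Rightarrow> 'n set) \<Rightarrow> 'r set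
      \<Rightarrow> 'n \<Rightarrow> 'r \<Rightarrow> ('n \<times> 'r) set"
  where "fraction S act N p m x = fraction_rel S act N p `` {(m, x)}"

definition associated_sheaf ::
    "(nat \<Rightarrow> 'r::comm_ring_1 set) \<Rightarrow> ('r \<Rightarrow> 'n::ab_group_add \<Rightarrow> 'n) \<Rightarrow> (nat \<Rightarrow> 'n set)
      \<Rightarrow> ('r set, ('r \<times> 'r) set, ('n \<times> 'r) set) module_sheaf"
  where "associated_sheaf S act N = \<lparr>
    sections = (\<lambda>U. {s \<in> (\<Pi>\<^sub>E p\<in>U. homogeneous_fractions S N p // fraction_rel S act N p).
      \<forall>p\<in>U. \<exists>V n m x. openin (Proj_topology S) V \<and> p \<in> V \<and> V \<subseteq> U \<and> m \<in> N n \<and> x \<in> S n \<and>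
        (\<forall>q\<in>V. x \<notin> q \<and> s q = fraction S act N q m x)}),
    stalk_add = (\<lambda>p A B. \<Union>(m, x)\<in>A. \<Union>(m', x')\<in>B.
      fraction S act N p (act x' m + act x m') (x * x')),
    stalk_smult = (\<lambda>p A B. \<Union>(r, z)\<in>A. \<Union>(m, x)\<in>B.
      fraction S act N p (act r m) (z * x))\<rparr>"

definition Proj_structure_sheaf ::
    "(nat \<Rightarrow> 'r::comm_ring_1 set) \<Rightarrow> ('r set, ('r \<times> 'r) set, ('r \<times> 'r) set) module_sheaf"
  where "Proj_structure_sheaf S = associated_sheaf S (*) S"

definition twisting_sheaf ::
    "(nat \<Rightarrow> 'r::comm_ring_1 set) \<Rightarrow> nat \<Rightarrow> ('r set, ('r \<times> 'r) set, ('r \<times> 'r) set) module_sheaf"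
  where "twisting_sheaf S s = associated_sheaf S (*) (\<lambda>n. S (n + s))"

text \<open>
  For a sheaf of modules \<open>\<F>\<close> on Proj, the twist \<open>\<F>(s)\<close> is its tensor product with
  \<open>twisting_sheaf S s\<close>.
\<close>

definition Proj_regular ::
    "(nat \<Rightarrow> 'r::comm_ring_1 set) \<Rightarrow> nat \<Rightarrow> ('r set, ('r \<times> 'r) set, 'v) module_sheaf
      \<Rightarrow> ('r set \<Rightarrow> ('r \<times> 'r) set) \<Rightarrow> bool"
  where "Proj_regular S s \<F> \<sigma> \<longleftrightarrow>
    regular_section (Proj_topology S) (Proj_structure_sheaf S) \<F> (twisting_sheaf S s) \<sigma>"


section \<open>The blowup\<close>

text \<open>
  \<open>B(R)\<close> and \<open>B(M)\<close> live inside \<open>R[t]\<close> and \<open>M[t]\<close>; elements of \<open>M[t]\<close> are represented as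
  \<open>'b poly\<close>, and \<open>poly_scale\<close> is the action of \<open>R[t]\<close> on \<open>M[t]\<close>.
\<close>

definition rees_ring :: "'a::comm_ring_1 set \<Rightarrow> nat \<Rightarrow> 'a poly set"
  where "rees_ring I n = {monom c n | c. c \<in> ideal_power I n}"

definition rees_module ::
    "('a::comm_ring_1 \<Rightarrow> 'b::ab_group_add \<Rightarrow> 'b) \<Rightarrow> 'a set \<Rightarrow> nat \<Rightarrow> 'b poly set"
  where "rees_module scale I n = {monom m n | m. m \<in> ideal_times scale (ideal_power I n) UNIV}"

definition poly_scale ::
    "('a::comm_ring_1 \<Rightarrow> 'b::ab_group_add \<Rightarrow> 'b) \<Rightarrow> 'a poly \<Rightarrow> 'b poly \<Rightarrow> 'b poly"
  where "poly_scale scale p q =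
    (\<Sum>i\<le>degree p. \<Sum>j\<le>degree q. monom (scale (coeff p i) (coeff q j)) (i + j))"

definition blowup_sheaf ::
    "('a::comm_ring_1 \<Rightarrow> 'b::ab_group_add \<Rightarrow> 'b) \<Rightarrow> 'a set
      \<Rightarrow> ('a poly set, ('a poly \<times> 'a poly) set, ('b poly \<times> 'a poly) set) module_sheaf"
  where "blowup_sheaf scale I =
    associated_sheaf (rees_ring I) (poly_scale scale) (rees_module scale I)"

definition alpha :: "'a::comm_ring_1 set \<Rightarrow> nat \<Rightarrow> 'a poly \<Rightarrow> 'a poly set \<Rightarrow> ('a poly \<times> 'a poly) set"
  where "alpha I s b =
    (\<lambda>p\<in>Proj_points (rees_ring I). fraction (rees_ring I) (*) (\<lambda>n. rees_ring I (n + s)) p b 1)"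

subsection \<open>Basic facts\<close>

lemma module_mult: "module ((*) :: 'a::comm_ring_1 \<Rightarrow> 'a \<Rightarrow> 'a)"
  by unfold_locales (simp_all add: algebra_simps)

lemma ideal_ideal_power: "is_ideal (ideal_power I n)"
proof (cases n)
  case 0
  then show ?thesis by (simp add: module.subspace_UNIV[OF module_mult])
next
  case (Suc k)
  then show ?thesis by (simp add: ideal_times_def module.subspace_span[OF module_mult])
qed

lemma zero_ideal_power: "0 \<in> ideal_power I n"
  using module.subspace_0[OF module_mult ideal_ideal_power] .

lemma ideal_power_mult:
  assumes "a \<in> ideal_power I m" "b \<in> ideal_power I n"
  shows "a * b \<in> ideal_power I (m + n)"
  using assms(1)
proof (induction m arbitrary: a)
  case 0
  then show ?case using assms(2) module.subspace_scale[OF module_mult ideal_ideal_power] by auto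
next
  case (Suc m)
  let ?P = "{c. c * b \<in> ideal_power I (Suc m + n)}"
  have sub: "is_ideal ?P"
  proof (rule module.subspaceI[OF module_mult])
    show "0 \<in> ?P" using zero_ideal_power[of I "Suc m + n"] by simp
  next
    fix x y assume "x \<in> ?P" "y \<in> ?P"
    then show "x + y \<in> ?P"
      using module.subspace_add[OF module_mult ideal_ideal_power[of I "Suc m + n"]]
      by (simp add: distrib_right del: ideal_power.simps)
  next
    fix c x assume "x \<in> ?P"
    then show "c * x \<in> ?P"
      using module.subspace_scale[OF module_mult ideal_ideal_power[of I "Suc m + n"]]
      by (simp add: mult.assoc del: ideal_power.simps)
  qed
  have "{u * v | u v. u \<in> I \<and> v \<in> ideal_power I m} \<subseteq> ?P"
  proof clarify
    fix u v assume uv: "u \<in> I" "v \<in> ideal_power I m"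
    have "u * (v * b) \<in> ideal_times (*) I (ideal_power I (m + n))"
      unfolding ideal_times_def
      using uv Suc.IH[OF uv(2)] by (intro module.span_base[OF module_mult]) blast
    then show "u * v * b \<in> ideal_power I (Suc m + n)" by (simp add: mult.assoc)
  qed
  then have "ideal_power I (Suc m) \<subseteq> ?P"
    using module.span_minimal[OF module_mult _ sub] by (simp add: ideal_times_def)
  then show ?case using Suc.prems by blast
qed

lemma openin_rees_Proj: "openin (Proj_topology (rees_ring I)) = Proj_open (rees_ring I)"
proof (rule openin_Proj_topology)
  show "0 \<in> rees_ring I n" for n
    unfolding rees_ring_def using zero_ideal_power[of I n] by (auto intro!: exI[of _ 0])
  show "a * b \<in> rees_ring I (m + n)" if "a \<in> rees_ring I m" "b \<in> rees_ring I n" for m n a b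
    using that ideal_power_mult by (auto simp: rees_ring_def mult_monom)
qed

lemma one_rees_ring: "1 \<in> rees_ring I 0"
  unfolding rees_ring_def by (auto intro!: exI[of _ 1] simp: monom_0 one_pCons)

lemma topspace_rees_Proj: "topspace (Proj_topology (rees_ring I)) = Proj_points (rees_ring I)"
proof -
  have "Proj_open (rees_ring I) (Proj_points (rees_ring I))"
    unfolding Proj_open_def
    using one_rees_ring[of I]
    by (intro exI[of _ "{1}"]) (auto simp: Proj_points_def homogeneous_prime_def)
  moreover have "U \<subseteq> Proj_points (rees_ring I)" if "Proj_open (rees_ring I) U" for U
    using that unfolding Proj_open_def by auto
  ultimately show ?thesis unfolding topspace_def openin_rees_Proj by blast
qed

lemma alpha_global_section:
  assumes "f \<in> ideal_power I s"
  shows "alpha I s (monom f s) \<in> sections (twisting_sheaf (rees_ring I) s) (Proj_points (rees_ring I))"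
proof -
  let ?S = "rees_ring I" and ?X = "Proj_points (rees_ring I)"
  let ?N = "\<lambda>n. rees_ring I (n + s)"
  have b: "monom f s \<in> ?N 0" using assms unfolding rees_ring_def by auto
  have o: "openin (Proj_topology ?S) ?X"
    using openin_topspace[of "Proj_topology ?S"] by (simp add: topspace_rees_Proj)
  have n1: "1 \<notin> p" if "p \<in> ?X" for p
    using that unfolding Proj_points_def homogeneous_prime_def by blast
  have "(monom f s, 1) \<in> homogeneous_fractions ?S ?N p" if "p \<in> ?X" for p
    unfolding homogeneous_fractions_def using b one_rees_ring[of I] n1[OF that] by blast
  then have "alpha I s (monom f s) \<in> (\<Pi>\<^sub>E p\<in>?X. homogeneous_fractions ?S ?N p // fraction_rel ?S (*) ?N p)"
    unfolding alpha_def fraction_def by (auto intro: quotientI)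
  moreover have "\<forall>p\<in>?X. \<exists>V n m x. openin (Proj_topology ?S) V \<and> p \<in> V \<and> V \<subseteq> ?X \<and> m \<in> ?N n \<and> x \<in> ?S n \<and>
        (\<forall>q\<in>V. x \<notin> q \<and> alpha I s (monom f s) q = fraction ?S (*) ?N q m x)"
  proof
    fix p assume p: "p \<in> ?X"
    show "\<exists>V n m x. openin (Proj_topology ?S) V \<and> p \<in> V \<and> V \<subseteq> ?X \<and> m \<in> ?N n \<and> x \<in> ?S n \<and>
        (\<forall>q\<in>V. x \<notin> q \<and> alpha I s (monom f s) q = fraction ?S (*) ?N q m x)"
      by (rule exI[of _ ?X], rule exI[of _ 0], rule exI[of _ "monom f s"], rule exI[of _ 1])
        (use p o b one_rees_ring[of I] n1 in \<open>auto simp: alpha_def\<close>)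
  qed
  ultimately show ?thesis unfolding twisting_sheaf_def associated_sheaf_def by simp
qed

lemma poly_scale_monom:
  assumes "module scale"
  shows "poly_scale scale (monom a i) (monom m j) = monom (scale a m) (i + j)"
proof (cases "a = 0 \<or> m = 0")
  case True
  then show ?thesis
    by (auto simp: poly_scale_def module.scale_zero_left[OF assms] module.scale_zero_right[OF assms])
next
  case False
  have "(\<Sum>i'\<le>i. \<Sum>j'\<le>j. monom (scale (coeff (monom a i) i') (coeff (monom m j) j')) (i' + j'))
    = (\<Sum>i'\<le>i. \<Sum>j'\<le>j. if j' = j then (if i' = i then monom (scale a m) (i + j) else 0) else 0)"
    by (intro sum.cong refl)
      (auto simp: module.scale_zero_left[OF assms] module.scale_zero_right[OF assms])
  then show ?thesis using False by (simp add: poly_scale_def degree_monom_eq)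
qed

end

theory Submission
  imports Defs
begin

text \<open>
  Write \<open>M\<^sub>h\<close> for the localization of \<open>M\<close> at the powers of \<open>h\<close>. On the chart \<open>D\<^sub>+(h t)\<close> with
  \<open>h \<in> I\<close>, the module \<open>\<B>(M)\<close> is a submodule of \<open>M\<^sub>h\<close> containing the image of \<open>M\<close>, the sheaf
  \<open>\<O>(s)\<close> is free on \<open>(h t)\<^sup>s\<close>, and \<open>\<alpha>\<^sub>s(f t\<^sup>s)\<close> is \<open>f / h\<^sup>s\<close> times this basis. So regularity of the
  section says that \<open>f\<close> is injective on \<open>M\<^sub>h\<close> for every \<open>h \<in> I\<close>. An element of \<open>M\<close> is zero in all
  these \<open>M\<^sub>h\<close> if and only if it is killed by a power of each \<open>h \<in> I\<close>; as \<open>I\<close> is finitely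
  generated, this means that it lies in \<open>\<Gamma>\<^sub>I(M)\<close>. Hence if \<open>f\<close> is injective on all \<open>M\<^sub>h\<close>, then
  \<open>f m \<in> \<Gamma>\<^sub>I(M)\<close> implies \<open>m \<in> \<Gamma>\<^sub>I(M)\<close>. Conversely, if \<open>f\<close> is injective modulo \<open>\<Gamma>\<^sub>I(M)\<close> and
  \<open>h\<^sup>k f m = 0\<close>, then \<open>h\<^sup>k m \<in> \<Gamma>\<^sub>I(M)\<close>, so a further power of \<open>h\<close> kills \<open>m\<close>.

  The proof below carries out this argument with stalks and pure tensors.

  \<^item> For injectivity of multiplication by the section, two pure tensors \<open>a \<otimes> \<sigma>\<close> and \<open>a' \<otimes> \<sigma>\<close>
    that agree near a point are compared through multiplication of fractions, a balanced map into
    the localization at that point (\<open>loc_eq_if_tensor_eq\<close>). This gives \<open>f w = 0\<close> for a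
    cross-multiplied difference \<open>w\<close> of the two fractions, and then \<open>w\<close> is torsion and dies in the
    stalk (\<open>regular_if_inj_mod_torsion\<close>).
  \<^item> In the other direction, let \<open>f m\<close> be torsion. Moving \<open>f / h\<^sup>s\<close> across the tensor sign shows
    that the global section \<open>m / 1\<close> has product zero with the section, hence vanishes. If no power
    of \<open>h\<close> killed \<open>m\<close>, a prime ideal of \<open>R\<close> containing the annihilator of \<open>m\<close> but not \<open>h\<close>
    (\<open>prime_avoiding_powers\<close>) would give a point of the blowup (\<open>point_of_prime\<close>) at which \<open>m / 1\<close>
    is not zero (\<open>inj_mod_torsion_if_regular\<close>).
\<close>

section \<open>Ideals, their powers and torsion\<close>

interpretation ideal: module "(*) :: 'a::comm_ring_1 \<Rightarrow> 'a \<Rightarrow> 'a"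
  by (rule module_mult)

text \<open>As a simplification rule, this would undo the usual reassociation of products.\<close>

declare ideal.scale_scale [simp del]

lemma ideal_power_antimono:
  assumes "m \<le> n"
  shows "ideal_power I n \<subseteq> ideal_power I m"
proof -
  have "ideal_power I (k + m) \<subseteq> ideal_power I m" for k
  proof
    fix c assume "c \<in> ideal_power I (k + m)"
    then show "c \<in> ideal_power I m"
    proof (induction k arbitrary: c)
      case (Suc k)
      have "ideal_power I (Suc k + m) \<subseteq> ideal_power I (k + m)"
        unfolding add_Suc ideal_power.simps(2) ideal_times_def
        by (rule ideal.span_minimal)
          (auto intro: ideal.subspace_scale[OF ideal_ideal_power] ideal_ideal_power)
      then show ?case using Suc by blast
    qed simp
  qed
  from this[of "n - m"] show ?thesis using assms by simp
qed

lemma power_in_ideal_power: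
  assumes "h \<in> I"
  shows "h ^ n \<in> ideal_power I n"
proof (induction n)
  case (Suc n)
  then show ?case
    unfolding power_Suc ideal_power.simps ideal_times_def
    using assms by (intro ideal.span_base) blast
qed simp

lemma ideal_power_1:
  assumes "is_ideal I"
  shows "ideal_power I 1 = I"
proof
  have "u * v \<in> I" if "u \<in> I" for u v
    using ideal.subspace_scale[OF assms that, of v] by (simp add: mult.commute)
  then have "{u * v | u v. u \<in> I \<and> v \<in> UNIV} \<subseteq> I" by blast
  then show "ideal_power I 1 \<subseteq> I"
    using ideal.span_minimal[OF _ assms] by (simp add: ideal_times_def)
  show "I \<subseteq> ideal_power I 1"
    using power_in_ideal_power[of _ I 1] by auto
qed

text \<open>
  The torsion is a submodule because the annihilators of the powers of \<open>I\<close> form a chain.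
\<close>

lemma subspace_torsion:
  assumes "module scale"
  shows "module.subspace scale (torsion scale I)"
proof -
  interpret module scale by fact
  show ?thesis
  proof (rule subspaceI)
    show "0 \<in> torsion scale I"
      by (auto simp: torsion_def annihilated_by_def)
  next
    fix x y assume "x \<in> torsion scale I" "y \<in> torsion scale I"
    then obtain i j where i: "\<forall>a\<in>ideal_power I i. scale a x = 0"
      and j: "\<forall>a\<in>ideal_power I j. scale a y = 0"
      by (auto simp: torsion_def annihilated_by_def)
    have "\<forall>a\<in>ideal_power I (max i j). scale a (x + y) = 0"
      using i j ideal_power_antimono[of i "max i j" I] ideal_power_antimono[of j "max i j" I]
      by (auto simp: scale_right_distrib subset_iff)
    then show "x + y \<in> torsion scale I"
      by (auto simp: torsion_def annihilated_by_def)
  next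
    fix c x assume "x \<in> torsion scale I"
    then obtain i where i: "\<forall>a\<in>ideal_power I i. scale a x = 0"
      by (auto simp: torsion_def annihilated_by_def)
    have "\<forall>a\<in>ideal_power I i. scale a (scale c x) = 0"
      using i by (metis scale_left_commute scale_zero_right)
    then show "scale c x \<in> torsion scale I"
      by (auto simp: torsion_def annihilated_by_def)
  qed
qed

text \<open>
  A product of \<open>i + j\<close> elements of \<open>J + (h)\<close> either uses \<open>h\<close> at least \<open>i\<close> times or takes at least
  \<open>j\<close> factors from \<open>J\<close>.
\<close>

lemma ideal_power_span_insert:
  "ideal_power (ideal.span (insert h A)) (i + j)
    \<subseteq> {c * h ^ i + b | c b. b \<in> ideal_power (ideal.span A) j}"
proof -
  let ?J = "ideal_power (ideal.span A)"
  let ?Q = "\<lambda>i j. {c * h ^ i + b | c b. b \<in> ?J j}"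
  have sub: "is_ideal (?Q i j)" for i j
  proof (rule ideal.subspaceI)
    show "0 \<in> ?Q i j"
      using zero_ideal_power[of "ideal.span A" j] by (auto intro!: exI[of _ 0])
  next
    fix x y assume "x \<in> ?Q i j" "y \<in> ?Q i j"
    then obtain c b c' b' where "x = c * h ^ i + b" "y = c' * h ^ i + b'" "b \<in> ?J j" "b' \<in> ?J j"
      by auto
    then show "x + y \<in> ?Q i j"
      using ideal.subspace_add[OF ideal_ideal_power, of b "ideal.span A" j b']
      by (intro CollectI exI[of _ "c + c'"] exI[of _ "b + b'"]) (simp add: algebra_simps)
  next
    fix r x assume "x \<in> ?Q i j"
    then obtain c b where x: "x = c * h ^ i + b" and b: "b \<in> ?J j" by auto
    have "r * x = r * c * h ^ i + r * b" by (simp add: x distrib_left mult.assoc)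
    moreover have "r * b \<in> ?J j" by (rule ideal.subspace_scale[OF ideal_ideal_power b])
    ultimately show "r * x \<in> ?Q i j" by blast
  qed
  show ?thesis
  proof (induction "i + j" arbitrary: i j)
    case 0
    then show ?case by auto (metis add_0)
  next
    case (Suc n)
    show ?case
    proof (cases "i = 0 \<or> j = 0")
      case True
      then show ?thesis
      proof
        assume "i = 0"
        have "x \<in> ?Q 0 j" for x
        proof -
          have "x = x * h ^ 0 + 0" by simp
          then show ?thesis using zero_ideal_power[of "ideal.span A" j] by blast
        qed
        then show ?thesis using \<open>i = 0\<close> by blast
      next
        assume "j = 0"
        have "x \<in> ?Q i 0" for x
        proof -
          have "x = 0 * h ^ i + x \<and> x \<in> ?J 0" by simp
          then show ?thesis by blast
        qed
        then show ?thesis using \<open>j = 0\<close> by blast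
      qed
    next
      case False
      then obtain i' j' where ij: "i = Suc i'" "j = Suc j'" by (metis not0_implies_Suc)
      have n1: "n = i' + j" and n2: "n = i + j'" using Suc(2) ij by auto
      let ?K = "ideal.span (insert h A)"
      have "{u * w | u w. u \<in> ?K \<and> w \<in> ideal_power ?K n} \<subseteq> ?Q i j"
      proof clarify
        fix u w assume u: "u \<in> ?K" and w: "w \<in> ideal_power ?K n"
        obtain k where k: "u - k * h \<in> ideal.span A" using u by (auto simp: ideal.span_insert)
        obtain c b where 1: "w = c * h ^ i' + b" "b \<in> ?J j" using Suc(1)[OF n1] w n1 by auto
        have hw: "k * h * w \<in> ?Q i j"
        proof -
          have "k * h * b \<in> ?J j"
            using ideal.subspace_scale[OF ideal_ideal_power, of b "ideal.span A" j "k * h"] 1 by simp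
          moreover have "k * h * w = k * c * h ^ i + k * h * b"
            by (simp add: 1 ij algebra_simps)
          ultimately show ?thesis by blast
        qed
        obtain c' b' where 2: "w = c' * h ^ i + b'" "b' \<in> ?J j'" using Suc(1)[OF n2] w n2 by auto
        have Aw: "(u - k * h) * w \<in> ?Q i j"
        proof -
          have "(u - k * h) * b' \<in> ?J j"
            unfolding ij ideal_power.simps ideal_times_def
            using k 2 by (intro ideal.span_base) auto
          moreover have "(u - k * h) * w = (u - k * h) * c' * h ^ i + (u - k * h) * b'"
            by (simp add: 2 algebra_simps)
          ultimately show ?thesis by blast
        qed
        show "\<exists>c b. u * w = c * h ^ i + b \<and> b \<in> ?J j"
          using ideal.subspace_add[OF sub hw Aw] by (simp add: algebra_simps)
      qed
      then have "ideal_power ?K (Suc n) \<subseteq> ?Q i j"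
        unfolding ideal_power.simps ideal_times_def by (rule ideal.span_minimal[OF _ sub])
      then show ?thesis using Suc(2) by simp
    qed
  qed
qed

text \<open>
  Torsion for a finitely generated ideal can be tested on one generator at a time, by adding the
  generators one after the other and splitting the powers as above. In a noetherian ring this
  covers every ideal.
\<close>

lemma torsion_spanI:
  assumes "module scale" and "finite A" and "\<forall>h\<in>A. \<exists>k. scale (h ^ k) m = 0"
  shows "m \<in> torsion scale (ideal.span A)"
  using assms(2,3)
proof (induction A rule: finite_induct)
  case empty
  interpret module scale by fact
  have "ideal_power (ideal.span {}) 1 = {0::'a}"
    using ideal_power_1[OF ideal.subspace_span, of "{}"] by simp
  then have "m \<in> annihilated_by scale (ideal_power (ideal.span {}) 1)"
    unfolding annihilated_by_def by simp
  then show ?case unfolding torsion_def by blast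
next
  case (insert h A)
  interpret module scale by fact
  obtain j where j: "\<forall>b\<in>ideal_power (ideal.span A) j. scale b m = 0"
    using insert by (auto simp: torsion_def annihilated_by_def)
  obtain i where i: "scale (h ^ i) m = 0" using insert by auto
  have "scale a m = 0" if a: "a \<in> ideal_power (ideal.span (insert h A)) (i + j)" for a
  proof -
    obtain c b where "a = c * h ^ i + b" "b \<in> ideal_power (ideal.span A) j"
      using ideal_power_span_insert[of h A i j] a by auto
    then show ?thesis
      using i j by (simp add: scale_left_distrib flip: scale_scale)
  qed
  then show ?case by (auto simp: torsion_def annihilated_by_def)
qed

lemma inj_on_quotient_mult_iff:
  assumes "module scale" and "module.subspace scale N"
  shows "inj_on (quotient_mult scale N f) (UNIV // mod_rel N)
    \<longleftrightarrow> (\<forall>m. scale f m \<in> N \<longrightarrow> m \<in> N)"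
proof -
  interpret module scale by fact
  have eq: "mod_rel N `` {x} = mod_rel N `` {y} \<longleftrightarrow> x - y \<in> N" for x y
  proof
    assume "mod_rel N `` {x} = mod_rel N `` {y}"
    moreover have "y \<in> mod_rel N `` {y}"
      using subspace_0[OF assms(2)] by (simp add: mod_rel_def)
    ultimately have "y \<in> mod_rel N `` {x}" by simp
    then show "x - y \<in> N" by (simp add: mod_rel_def)
  next
    assume xy: "x - y \<in> N"
    have "x - z \<in> N \<longleftrightarrow> y - z \<in> N" for z
      using subspace_add[OF assms(2) xy, of "y - z"] subspace_diff[OF assms(2) _ xy, of "x - z"]
      by auto
    then show "mod_rel N `` {x} = mod_rel N `` {y}" by (auto simp: mod_rel_def)
  qed
  have mult: "quotient_mult scale N f (mod_rel N `` {x}) = mod_rel N `` {scale f x}" for x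
  proof -
    have "mod_rel N `` {scale f z} = mod_rel N `` {scale f x}" if "z \<in> mod_rel N `` {x}" for z
    proof -
      have "scale f (x - z) \<in> N"
        using that subspace_scale[OF assms(2)] by (simp add: mod_rel_def)
      then have "mod_rel N `` {scale f x} = mod_rel N `` {scale f z}"
        unfolding eq by (simp add: scale_right_diff_distrib)
      then show ?thesis by simp
    qed
    moreover have "x \<in> mod_rel N `` {x}"
      using subspace_0[OF assms(2)] by (simp add: mod_rel_def)
    ultimately show ?thesis unfolding quotient_mult_def by blast
  qed
  have "inj_on (quotient_mult scale N f) (UNIV // mod_rel N)
    \<longleftrightarrow> (\<forall>x y. scale f x - scale f y \<in> N \<longrightarrow> x - y \<in> N)"
    by (auto simp: inj_on_def quotient_def mult eq)
  also have "\<dots> \<longleftrightarrow> (\<forall>m. scale f m \<in> N \<longrightarrow> m \<in> N)"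
    by (metis diff_zero scale_right_diff_distrib scale_zero_right)
  finally show ?thesis .
qed

section \<open>Prime ideals avoiding the powers of an element\<close>

text \<open>
  An ideal that is maximal among those containing \<open>J\<close> and no power of \<open>h\<close> is prime: for \<open>a\<close>, \<open>b\<close>
  outside it the ideals it generates with \<open>a\<close> and with \<open>b\<close> contain powers of \<open>h\<close>, so their
  product does, and that product lies in the ideal if \<open>a * b\<close> does.
\<close>

lemma prime_avoiding_powers:
  assumes J: "is_ideal J" and h: "\<And>n. h ^ n \<notin> J"
  shows "\<exists>q. is_ideal q \<and> J \<subseteq> q \<and> (\<forall>n. h ^ n \<notin> q) \<and> (\<forall>a b. a * b \<in> q \<longrightarrow> a \<in> q \<or> b \<in> q)"
proof -
  let ?A = "{q. is_ideal q \<and> J \<subseteq> q \<and> (\<forall>n. h ^ n \<notin> q)}"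
  have "\<exists>M\<in>?A. \<forall>X\<in>?A. M \<subseteq> X \<longrightarrow> X = M"
  proof (rule subset_Zorn_nonempty)
    show "?A \<noteq> {}" using J h by blast
    fix C assume ne: "C \<noteq> {}" and ch: "subset.chain ?A C"
    have CA: "\<And>q. q \<in> C \<Longrightarrow> is_ideal q \<and> J \<subseteq> q \<and> (\<forall>n. h ^ n \<notin> q)"
      and tot: "\<And>p q. p \<in> C \<Longrightarrow> q \<in> C \<Longrightarrow> p \<subseteq> q \<or> q \<subseteq> p"
      using ch unfolding subset.chain_def by auto
    have "is_ideal (\<Union>C)"
    proof (rule ideal.subspaceI)
      obtain p where "p \<in> C" using ne by blast
      with CA ideal.subspace_0[of p] show "0 \<in> \<Union>C" by blast
    next
      fix x y assume "x \<in> \<Union>C" "y \<in> \<Union>C"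
      then obtain p where p: "p \<in> C" "x \<in> p" "y \<in> p" using tot by blast
      with CA ideal.subspace_add[of p x y] show "x + y \<in> \<Union>C" by blast
    next
      fix c x assume "x \<in> \<Union>C"
      then obtain p where "p \<in> C" "x \<in> p" by blast
      with CA ideal.subspace_scale[of p x c] show "c * x \<in> \<Union>C" by blast
    qed
    then show "\<Union>C \<in> ?A" using ne CA by blast
  qed
  then obtain q where qA: "q \<in> ?A" and qmax: "\<forall>X\<in>?A. q \<subseteq> X \<longrightarrow> X = q" ..
  then have q: "is_ideal q" "J \<subseteq> q" "\<And>n. h ^ n \<notin> q" by simp_all
  have max: "X = q" if "is_ideal X" "q \<subseteq> X" "\<And>n. h ^ n \<notin> X" for X
  proof -
    have "X \<in> ?A" using that q(2) by simp
    then show ?thesis using qmax that(2) by simp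
  qed
  have pow: "\<exists>n k. h ^ n - k * a \<in> q" if "a \<notin> q" for a
  proof -
    let ?X = "ideal.span (insert a q)"
    have "q \<subseteq> ?X" "a \<in> ?X" by (auto intro: ideal.span_base)
    then have "\<exists>n. h ^ n \<in> ?X" using max[OF ideal.subspace_span, of "insert a q"] that by metis
    moreover have "ideal.span q = q" using q(1) by simp
    ultimately show ?thesis by (simp add: ideal.span_insert)
  qed
  have prime: "a \<in> q \<or> b \<in> q" if ab: "a * b \<in> q" for a b
  proof (rule ccontr)
    assume "\<not> (a \<in> q \<or> b \<in> q)"
    then obtain i k j l where a: "h ^ i - k * a \<in> q" and b: "h ^ j - l * b \<in> q"
      using pow by blast
    have "h ^ j * (h ^ i - k * a) + (k * a * (h ^ j - l * b) + k * l * (a * b)) \<in> q"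
      by (intro ideal.subspace_add[OF q(1)] ideal.subspace_scale[OF q(1) a]
          ideal.subspace_scale[OF q(1) b] ideal.subspace_scale[OF q(1) ab])
    moreover have "h ^ j * (h ^ i - k * a) + (k * a * (h ^ j - l * b) + k * l * (a * b)) = h ^ (i + j)"
      by (simp add: algebra_simps power_add)
    ultimately show False using q(3) by simp
  qed
  show ?thesis
    by (intro exI[of _ q] conjI allI impI q prime)
qed

section \<open>Tensor products of sheaves of modules\<close>

text \<open>
  A sheaf is given here by bare sets of functions, so that sections restrict to sections and are
  closed under the module operations has to be required.
\<close>

locale tensor_data =
  fixes X :: "'p topology"
    and \<O> :: "('p, 'c, 'c) module_sheaf"
    and \<F> :: "('p, 'c, 'v) module_sheaf"
    and \<G> :: "('p, 'c, 'w) module_sheaf"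
  assumes restrict_ring: "\<And>U V r. openin X U \<Longrightarrow> openin X V \<Longrightarrow> V \<subseteq> U \<Longrightarrow> r \<in> sections \<O> U
      \<Longrightarrow> restrict r V \<in> sections \<O> V"
    and restrict_left: "\<And>U V a. openin X U \<Longrightarrow> openin X V \<Longrightarrow> V \<subseteq> U \<Longrightarrow> a \<in> sections \<F> U
      \<Longrightarrow> restrict a V \<in> sections \<F> V"
    and restrict_right: "\<And>U V b. openin X U \<Longrightarrow> openin X V \<Longrightarrow> V \<subseteq> U \<Longrightarrow> b \<in> sections \<G> U
      \<Longrightarrow> restrict b V \<in> sections \<G> V"
    and add_left: "\<And>U a a'. openin X U \<Longrightarrow> a \<in> sections \<F> U \<Longrightarrow> a' \<in> sections \<F> U
      \<Longrightarrow> section_add \<F> U a a' \<in> sections \<F> U"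
    and add_right: "\<And>U b b'. openin X U \<Longrightarrow> b \<in> sections \<G> U \<Longrightarrow> b' \<in> sections \<G> U
      \<Longrightarrow> section_add \<G> U b b' \<in> sections \<G> U"
    and smult_left: "\<And>U r a. openin X U \<Longrightarrow> r \<in> sections \<O> U \<Longrightarrow> a \<in> sections \<F> U
      \<Longrightarrow> section_smult \<F> U r a \<in> sections \<F> U"
    and smult_right: "\<And>U r b. openin X U \<Longrightarrow> r \<in> sections \<O> U \<Longrightarrow> b \<in> sections \<G> U
      \<Longrightarrow> section_smult \<G> U r b \<in> sections \<G> U"
begin

abbreviation pairs :: "'p set \<Rightarrow> (('p \<Rightarrow> 'v) \<times> ('p \<Rightarrow> 'w)) set"
  where "pairs U \<equiv> sections \<F> U \<times> sections \<G> U"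

abbreviation relations where "relations \<equiv> tensor_relations \<O> \<F> \<G>"
abbreviation kernel where "kernel \<equiv> tensor_kernel \<O> \<F> \<G>"
abbreviation cls where "cls \<equiv> tensor_class \<O> \<F> \<G>"
abbreviation res where "res \<equiv> tensor_restrict \<O> \<F> \<G>"
abbreviation P where "P \<equiv> (\<lambda>U. carrier (tensor_presheaf \<O> \<F> \<G> U))"

abbreviation restrict_free ::
    "'p set \<Rightarrow> (('p \<Rightarrow> 'v) \<times> ('p \<Rightarrow> 'w) \<Rightarrow>\<^sub>0 int) \<Rightarrow> (('p \<Rightarrow> 'v) \<times> ('p \<Rightarrow> 'w) \<Rightarrow>\<^sub>0 int)"
  where "restrict_free V \<equiv> frag_extend (\<lambda>(a, b). frag_of (restrict a V, restrict b V))"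

lemma relation_cases [consumes 1]:
  assumes "c \<in> relations U"
  obtains
    (left) a a' b where "c = frag_of (section_add \<F> U a a', b) - frag_of (a, b) - frag_of (a', b)"
      "a \<in> sections \<F> U" "a' \<in> sections \<F> U" "b \<in> sections \<G> U"
  | (right) a b b' where "c = frag_of (a, section_add \<G> U b b') - frag_of (a, b) - frag_of (a, b')"
      "a \<in> sections \<F> U" "b \<in> sections \<G> U" "b' \<in> sections \<G> U"
  | (scalar) r a b where "c = frag_of (section_smult \<F> U r a, b) - frag_of (a, section_smult \<G> U r b)"
      "r \<in> sections \<O> U" "a \<in> sections \<F> U" "b \<in> sections \<G> U"
  using assms unfolding tensor_relations_def by blast

text \<open>
  Inverses in a free abelian group make sense only on its carrier; the closure of sections under
  the module operations keeps the relations inside it.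
\<close>

lemma keys_relation:
  assumes "openin X U" and "c \<in> relations U"
  shows "Poly_Mapping.keys c \<subseteq> pairs U"
proof -
  have diff: "Poly_Mapping.keys (frag_of x - frag_of y) \<subseteq> {x, y}"
    "Poly_Mapping.keys (frag_of x - frag_of y - frag_of z) \<subseteq> {x, y, z}"
    for x y z :: "('p \<Rightarrow> 'v) \<times> ('p \<Rightarrow> 'w)"
    using keys_diff[of "frag_of x" "frag_of y"] keys_diff[of "frag_of x - frag_of y" "frag_of z"]
    by auto
  from assms(2) show ?thesis
  proof (cases rule: relation_cases)
    case (left a a' b)
    then show ?thesis using diff(2) add_left[OF assms(1) left(2,3)] by blast
  next
    case (right a b b')
    then show ?thesis using diff(2) add_right[OF assms(1) right(3,4)] by blast
  next
    case (scalar r a b)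
    then show ?thesis
      using diff(1) smult_left[OF assms(1) scalar(2,3)] smult_right[OF assms(1) scalar(2,4)] by blast
  qed
qed

lemma subgroup_kernel:
  assumes "openin X U"
  shows "subgroup (kernel U) (tensor_free \<F> \<G> U)"
  unfolding tensor_kernel_def
  using keys_relation[OF assms] by (intro group.generate_is_subgroup) auto

lemma kernel_closed:
  assumes "openin X U"
  shows kernel_zero: "0 \<in> kernel U"
    and kernel_add: "\<And>c d. c \<in> kernel U \<Longrightarrow> d \<in> kernel U \<Longrightarrow> c + d \<in> kernel U"
    and kernel_minus: "\<And>c. c \<in> kernel U \<Longrightarrow> - c \<in> kernel U"
    and keys_kernel: "\<And>c. c \<in> kernel U \<Longrightarrow> Poly_Mapping.keys c \<subseteq> pairs U"
proof -
  interpret K: subgroup "kernel U" "tensor_free \<F> \<G> U" by (rule subgroup_kernel[OF assms])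
  show "0 \<in> kernel U" using K.one_closed by simp
  show "c + d \<in> kernel U" if "c \<in> kernel U" "d \<in> kernel U" for c d
    using K.m_closed[OF that] by simp
  show keys: "Poly_Mapping.keys c \<subseteq> pairs U" if "c \<in> kernel U" for c
    using K.mem_carrier[OF that] by simp
  show "- c \<in> kernel U" if "c \<in> kernel U" for c
    using K.m_inv_closed[OF that] keys[OF that] by simp
qed

lemma kernel_induct [consumes 2, case_names zero relation minus add]:
  assumes "openin X U" and "c \<in> kernel U"
    and "Q 0"
    and relation: "\<And>c. c \<in> relations U \<Longrightarrow> Poly_Mapping.keys c \<subseteq> pairs U \<Longrightarrow> Q c"
    and minus: "\<And>c. c \<in> relations U \<Longrightarrow> Poly_Mapping.keys c \<subseteq> pairs U \<Longrightarrow> Q (- c)"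
    and add: "\<And>c d. c \<in> kernel U \<Longrightarrow> d \<in> kernel U \<Longrightarrow> Q c \<Longrightarrow> Q d \<Longrightarrow> Q (c + d)"
  shows "Q c"
  using assms(2) unfolding tensor_kernel_def
proof (induction rule: generate.induct)
  case one
  then show ?case using assms(3) by simp
next
  case (incl h)
  then show ?case using relation keys_relation[OF assms(1)] by blast
next
  case (inv h)
  then show ?case using minus keys_relation[OF assms(1) inv] by simp
next
  case (eng h1 h2)
  then show ?case using add by (simp add: tensor_kernel_def)
qed

lemma mem_cls: "d \<in> cls U c \<longleftrightarrow> (\<exists>k\<in>kernel U. d = k + c)"
  by (auto simp: tensor_class_def r_coset_def)

lemma cls_eq_iff:
  assumes "openin X U"
  shows "cls U c = cls U d \<longleftrightarrow> c - d \<in> kernel U"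
proof
  assume "cls U c = cls U d"
  moreover have "c \<in> cls U c" using kernel_zero[OF assms] by (auto simp: mem_cls)
  ultimately obtain k where "k \<in> kernel U" "c = k + d" by (auto simp: mem_cls)
  then show "c - d \<in> kernel U" by simp
next
  assume k: "c - d \<in> kernel U"
  have "e \<in> cls U c \<longleftrightarrow> e \<in> cls U d" for e
  proof
    assume "e \<in> cls U c"
    then obtain l where "l \<in> kernel U" "e = l + c" by (auto simp: mem_cls)
    then show "e \<in> cls U d"
      using kernel_add[OF assms _ k] unfolding mem_cls
      by (intro bexI[of _ "l + (c - d)"]) auto
  next
    assume "e \<in> cls U d"
    then obtain l where "l \<in> kernel U" "e = l + d" by (auto simp: mem_cls)
    then show "e \<in> cls U c"
      using kernel_add[OF assms _ kernel_minus[OF assms k]] unfolding mem_cls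
      by (intro bexI[of _ "l + - (c - d)"]) auto
  qed
  then show "cls U c = cls U d" by blast
qed

lemma in_presheaf_iff: "t \<in> P U \<longleftrightarrow> (\<exists>c. Poly_Mapping.keys c \<subseteq> pairs U \<and> t = cls U c)"
  unfolding tensor_presheaf_def tensor_class_def FactGroup_def RCOSETS_def
  by (simp add: Bex_def)

lemma smult_balanced:
  assumes "openin X U" "r \<in> sections \<O> U" "a \<in> sections \<F> U" "b \<in> sections \<G> U"
  shows "cls U (frag_of (section_smult \<F> U r a, b)) = cls U (frag_of (a, section_smult \<G> U r b))"
proof -
  have "frag_of (section_smult \<F> U r a, b) - frag_of (a, section_smult \<G> U r b) \<in> relations U"
    unfolding tensor_relations_def using assms(2-4) by blast
  then show ?thesis
    unfolding cls_eq_iff[OF assms(1)] tensor_kernel_def by (rule generate.incl)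
qed

text \<open>
  Restriction of sections is compatible with all three kinds of relation, hence well defined on
  tensor products, and it is transitive there because it is so on pairs of sections.
\<close>

lemma restrict_free_kernel:
  assumes U: "openin X U" and V: "openin X V" "V \<subseteq> U" and c: "c \<in> kernel U"
  shows "restrict_free V c \<in> kernel V"
  using U c
proof (induction rule: kernel_induct)
  case zero
  show ?case using kernel_zero[OF V(1)] by simp
next
  have restrict_add: "restrict (section_add \<H> U a a') V = section_add \<H> V (restrict a V) (restrict a' V)"
    and restrict_smult: "restrict (section_smult \<H> U r a) V = section_smult \<H> V (restrict r V) (restrict a V)"
    for \<H> :: "('p, 'c, 'u) module_sheaf" and a a' r
    using V(2) by (auto simp: section_add_def section_smult_def restrict_def fun_eq_iff)
  have rel: "restrict_free V c \<in> kernel V" if c: "c \<in> relations U" for c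
  proof -
    note RF = restrict_left[OF U V] and RG = restrict_right[OF U V] and RO = restrict_ring[OF U V]
    from c have "restrict_free V c \<in> relations V"
    proof (cases rule: relation_cases)
      case (left a a' b)
      then show ?thesis
        unfolding tensor_relations_def using RF[of a] RF[of a'] RG[of b]
        by (auto simp: frag_extend_diff restrict_add)
    next
      case (right a b b')
      then show ?thesis
        unfolding tensor_relations_def using RF[of a] RG[of b] RG[of b']
        by (auto simp: frag_extend_diff restrict_add)
    next
      case (scalar r a b)
      then show ?thesis
        unfolding tensor_relations_def using RF[of a] RG[of b] RO[of r]
        by (auto simp: frag_extend_diff restrict_smult)
    qed
    then show ?thesis unfolding tensor_kernel_def by (rule generate.incl)
  qed
  {
    case (relation c)
    then show ?case using rel by blast
  next
    case (minus c)
    show ?case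
      by (subst frag_extend_minus) (rule kernel_minus[OF V(1) rel[OF minus(1)]])
  next
    case (add c d)
    then show ?case using kernel_add[OF V(1)] by (simp add: frag_extend_add)
  }
qed

lemma res_cls:
  assumes "openin X U" "openin X V" "V \<subseteq> U"
  shows "res V (cls U c) = cls V (restrict_free V c)"
proof -
  have "cls V (restrict_free V d) = cls V (restrict_free V c)" if "d \<in> cls U c" for d
  proof -
    from that obtain k where k: "k \<in> kernel U" "d = k + c" by (auto simp: mem_cls)
    then show ?thesis
      using restrict_free_kernel[OF assms k(1)]
      by (simp add: cls_eq_iff[OF assms(2)] frag_extend_add)
  qed
  moreover have "c \<in> cls U c" using kernel_zero[OF assms(1)] by (auto simp: mem_cls)
  ultimately show ?thesis unfolding tensor_restrict_def by blast
qed

lemma res_cls_pair: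
  assumes "openin X U" "openin X V" "V \<subseteq> U"
  shows "res V (cls U (frag_of (a, b))) = cls V (frag_of (restrict a V, restrict b V))"
  by (simp add: res_cls[OF assms])

lemma res_res:
  assumes "openin X U" "openin X V" "openin X W" "V \<subseteq> U" "W \<subseteq> V" and t: "t \<in> P U"
  shows "res W (res V t) = res W t"
proof -
  obtain c where c: "Poly_Mapping.keys c \<subseteq> pairs U" "t = cls U c" using t by (auto simp: in_presheaf_iff)
  have "restrict_free W (restrict_free V c) = restrict_free W c"
    using c(1)
  proof (induction c rule: frag_induction)
    case (one x)
    have "V \<inter> W = W" using assms(5) by blast
    then show ?case by (simp add: case_prod_beta del: restrict_apply)
  qed (simp_all add: frag_extend_diff)
  then show ?thesis
    using assms by (simp add: c(2) res_cls[of U V] res_cls[of V W] res_cls[of U W])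
qed

text \<open>
  A neighbourhood on which a third tensor agrees with \<open>t\<close> can be shrunk to lie in \<open>V\<close>, where
  \<open>t\<close> and \<open>t'\<close> agree.
\<close>

lemma germ_eqI:
  assumes U: "openin X U" and V: "openin X V" "x \<in> V" "V \<subseteq> U"
    and t: "t \<in> P U" "t' \<in> P U" and eq: "res V t = res V t'"
  shows "germ X P res x (U, t) = germ X P res x (U, t')"
proof -
  have "germ X P res x (U, t) \<subseteq> germ X P res x (U, t')"
    if t: "t \<in> P U" "t' \<in> P U" and eq: "res V t = res V t'" for t t'
  proof clarify
    fix W u assume "(W, u) \<in> germ X P res x (U, t)"
    then obtain Z where W: "openin X W" "x \<in> W" "u \<in> P W"
      and Z: "openin X Z" "x \<in> Z" "Z \<subseteq> U \<inter> W" "res Z t = res Z u"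
      by (auto simp: germ_def)
    let ?Z = "Z \<inter> V"
    have Z': "openin X ?Z" "x \<in> ?Z" "?Z \<subseteq> U \<inter> W" using Z V by auto
    have "res ?Z t' = res ?Z (res V t')" using res_res[OF U V(1) Z'(1) V(3) _ t(2)] by simp
    also have "\<dots> = res ?Z (res V t)" using eq by simp
    also have "\<dots> = res ?Z t" using res_res[OF U V(1) Z'(1) V(3) _ t(1)] by simp
    also have "\<dots> = res ?Z (res Z t)" using res_res[OF U Z(1) Z'(1) _ _ t(1)] Z(3) by simp
    also have "\<dots> = res ?Z (res Z u)" using Z(4) by simp
    also have "\<dots> = res ?Z u" using res_res[OF W(1) Z(1) Z'(1) _ _ W(3)] Z(3) by simp
    finally show "(W, u) \<in> germ X P res x (U, t')"
      unfolding germ_def using W Z' by auto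
  qed
  from this[OF t eq] this[OF t(2,1) eq[symmetric]] show ?thesis by (rule equalityI)
qed

text \<open>
  Equality of two products with \<open>\<sigma>\<close> can be tested on pure tensors over small open sets.
\<close>

lemma mult_section_eq_iff:
  assumes U: "openin X U" and a: "a \<in> sections \<F> U" "a' \<in> sections \<F> U"
    and \<sigma>: "restrict \<sigma> U \<in> sections \<G> U"
  shows "mult_section X \<O> \<F> \<G> \<sigma> U a = mult_section X \<O> \<F> \<G> \<sigma> U a' \<longleftrightarrow>
    (\<forall>x\<in>U. \<exists>V. openin X V \<and> x \<in> V \<and> V \<subseteq> U \<and>
      cls V (frag_of (restrict a V, restrict \<sigma> V)) = cls V (frag_of (restrict a' V, restrict \<sigma> V)))"
    (is "?L \<longleftrightarrow> ?R")
proof -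
  let ?t = "\<lambda>a. cls U (frag_of (a, restrict \<sigma> U))"
  have tP: "?t a \<in> P U" "?t a' \<in> P U"
  proof -
    have "?t b \<in> P U" if "b \<in> sections \<F> U" for b
      unfolding in_presheaf_iff using that \<sigma> by (intro exI[of _ "frag_of (b, restrict \<sigma> U)"]) simp
    then show "?t a \<in> P U" "?t a' \<in> P U" using a by blast+
  qed
  have res: "res V (?t b) = cls V (frag_of (restrict b V, restrict \<sigma> V))"
    if "openin X V" "V \<subseteq> U" for V b
  proof -
    have "restrict (restrict \<sigma> U) V = restrict \<sigma> V"
      using that(2) by (auto simp: restrict_def fun_eq_iff)
    then show ?thesis by (simp add: res_cls_pair[OF U that] del: restrict_apply)
  qed
  have L: "?L \<longleftrightarrow> (\<forall>x\<in>U. germ X P res x (U, ?t a) = germ X P res x (U, ?t a'))"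
    by (auto simp: mult_section_def restrict_def fun_eq_iff)
  show ?thesis
  proof
    assume ?L
    show ?R
    proof
      fix x assume x: "x \<in> U"
      have "(U, ?t a) \<in> germ X P res x (U, ?t a)"
        using U x tP(1) by (auto simp: germ_def)
      then have "(U, ?t a) \<in> germ X P res x (U, ?t a')" using \<open>?L\<close> L x by simp
      then obtain Z where "openin X Z" "x \<in> Z" "Z \<subseteq> U" "res Z (?t a') = res Z (?t a)"
        by (auto simp: germ_def)
      then show "\<exists>V. openin X V \<and> x \<in> V \<and> V \<subseteq> U \<and>
        cls V (frag_of (restrict a V, restrict \<sigma> V)) = cls V (frag_of (restrict a' V, restrict \<sigma> V))"
        using res[of Z] by metis
    qed
  next
    assume R: ?R
    show ?L unfolding L
    proof
      fix x assume "x \<in> U"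
      then obtain V where V: "openin X V" "x \<in> V" "V \<subseteq> U"
        "cls V (frag_of (restrict a V, restrict \<sigma> V)) = cls V (frag_of (restrict a' V, restrict \<sigma> V))"
        using R by blast
      then show "germ X P res x (U, ?t a) = germ X P res x (U, ?t a')"
        by (intro germ_eqI[OF U V(1-3) tP]) (simp add: res)
    qed
  qed
qed

text \<open>
  The universal property of the tensor product, in the only form in which tensors ever have to be
  told apart: a balanced biadditive map takes equal values on equal pure tensors.
\<close>

lemma balanced_eqI:
  assumes U: "openin X U" and "comm_group H"
    and closed: "\<And>a b. a \<in> sections \<F> U \<Longrightarrow> b \<in> sections \<G> U \<Longrightarrow> \<beta> (a, b) \<in> carrier H"
    and add1: "\<And>a a' b. a \<in> sections \<F> U \<Longrightarrow> a' \<in> sections \<F> U \<Longrightarrow> b \<in> sections \<G> U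
      \<Longrightarrow> \<beta> (section_add \<F> U a a', b) = \<beta> (a, b) \<otimes>\<^bsub>H\<^esub> \<beta> (a', b)"
    and add2: "\<And>a b b'. a \<in> sections \<F> U \<Longrightarrow> b \<in> sections \<G> U \<Longrightarrow> b' \<in> sections \<G> U
      \<Longrightarrow> \<beta> (a, section_add \<G> U b b') = \<beta> (a, b) \<otimes>\<^bsub>H\<^esub> \<beta> (a, b')"
    and bal: "\<And>r a b. r \<in> sections \<O> U \<Longrightarrow> a \<in> sections \<F> U \<Longrightarrow> b \<in> sections \<G> U
      \<Longrightarrow> \<beta> (section_smult \<F> U r a, b) = \<beta> (a, section_smult \<G> U r b)"
    and ab: "a \<in> sections \<F> U" "b \<in> sections \<G> U" "a' \<in> sections \<F> U" "b' \<in> sections \<G> U"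
    and eq: "cls U (frag_of (a, b)) = cls U (frag_of (a', b'))"
  shows "\<beta> (a, b) = \<beta> (a', b')"
proof -
  interpret H: comm_group H by fact
  obtain h where h: "h \<in> hom (tensor_free \<F> \<G> U) H" "\<And>x. x \<in> pairs U \<Longrightarrow> h (frag_of x) = \<beta> x"
    using H.free_Abelian_group_universal[of \<beta> "pairs U"] closed by blast
  have hadd: "h (x + y) = h x \<otimes>\<^bsub>H\<^esub> h y"
    if "Poly_Mapping.keys x \<subseteq> pairs U" "Poly_Mapping.keys y \<subseteq> pairs U" for x y
    using hom_mult[OF h(1), of x y] that by simp
  interpret hh: group_hom "tensor_free \<F> \<G> U" H h
    using h(1) by (simp add: group_hom_def group_hom_axioms_def)
  have h0: "h 0 = \<one>\<^bsub>H\<^esub>" using hh.hom_one by simp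
  have hminus: "h (- x) = inv\<^bsub>H\<^esub> h x" if "Poly_Mapping.keys x \<subseteq> pairs U" for x
    using hh.hom_inv[of x] that by simp
  have hdiff: "h (x - y) = h x \<otimes>\<^bsub>H\<^esub> inv\<^bsub>H\<^esub> h y"
    if "Poly_Mapping.keys x \<subseteq> pairs U" "Poly_Mapping.keys y \<subseteq> pairs U" for x y
    using hadd[of x "- y"] hminus[of y] that by simp
  have rel: "h c = \<one>\<^bsub>H\<^esub>" if c: "c \<in> relations U" for c
  proof -
    have three: "h (frag_of x - frag_of y - frag_of z) = \<one>\<^bsub>H\<^esub>"
      if "x \<in> pairs U" "y \<in> pairs U" "z \<in> pairs U" "\<beta> x = \<beta> y \<otimes>\<^bsub>H\<^esub> \<beta> z" for x y z
    proof -
      have "Poly_Mapping.keys (frag_of x - frag_of y) \<subseteq> pairs U"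
        using keys_diff[of "frag_of x" "frag_of y"] that by auto
      then have "h (frag_of x - frag_of y - frag_of z) = (\<beta> x \<otimes>\<^bsub>H\<^esub> inv\<^bsub>H\<^esub> \<beta> y) \<otimes>\<^bsub>H\<^esub> inv\<^bsub>H\<^esub> \<beta> z"
        using that by (simp add: hdiff h(2))
      moreover have "\<beta> y \<in> carrier H" "\<beta> z \<in> carrier H" using closed that(2,3) by auto
      ultimately show ?thesis
        using that(4) by (simp add: H.m_comm[of "\<beta> y" "\<beta> z"] H.m_assoc)
    qed
    from c show ?thesis
    proof (cases rule: relation_cases)
      case (left a a' b)
      then show ?thesis using add_left[OF U left(2,3)] add1 by (auto intro!: three)
    next
      case (right a b b')
      then show ?thesis using add_right[OF U right(3,4)] add2 by (auto intro!: three)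
    next
      case (scalar r a b)
      then show ?thesis
        using smult_left[OF U scalar(2,3)] smult_right[OF U scalar(2,4)] bal closed
        by (simp add: hdiff h(2))
    qed
  qed
  have ker: "h c = \<one>\<^bsub>H\<^esub>" if "c \<in> kernel U" for c
    using U that
  proof (induction rule: kernel_induct)
    case (minus c)
    then show ?case using rel by (simp add: hminus)
  next
    case (add c d)
    then show ?case using keys_kernel[OF U] by (simp add: hadd)
  qed (use h0 rel in auto)
  have "h (frag_of (a, b) - frag_of (a', b')) = \<one>\<^bsub>H\<^esub>"
    using eq ker by (simp add: cls_eq_iff[OF U])
  then have "\<beta> (a, b) \<otimes>\<^bsub>H\<^esub> inv\<^bsub>H\<^esub> \<beta> (a', b') = \<one>\<^bsub>H\<^esub>"
    using ab by (simp add: hdiff h(2))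
  then show ?thesis using closed ab by (metis H.inv_closed H.inv_inv H.inv_equality)
qed

end

section \<open>Localization of modules\<close>

text \<open>
  Equality of the fractions \<open>m / x\<close> and \<open>m' / x'\<close> in the localization at \<open>T\<close>.
\<close>

definition loc_eq ::
    "('r::comm_ring_1 \<Rightarrow> 'n::ab_group_add \<Rightarrow> 'n) \<Rightarrow> 'r set \<Rightarrow> 'n \<Rightarrow> 'r \<Rightarrow> 'n \<Rightarrow> 'r \<Rightarrow> bool"
  where "loc_eq act T m x m' x' \<longleftrightarrow> (\<exists>u\<in>T. act u (act x' m - act x m') = 0)"

definition loc_frac ::
    "('r::comm_ring_1 \<Rightarrow> 'n::ab_group_add \<Rightarrow> 'n) \<Rightarrow> 'r set \<Rightarrow> 'n \<Rightarrow> 'r \<Rightarrow> ('n \<times> 'r) set"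
  where "loc_frac act T m x = {(m', x'). x' \<in> T \<and> loc_eq act T m x m' x'}"

text \<open>
  Sums are unions over representatives, as for \<open>stalk_add\<close>. The group is the target in which
  tensors are compared.
\<close>

definition loc_group ::
    "('r::comm_ring_1 \<Rightarrow> 'n::ab_group_add \<Rightarrow> 'n) \<Rightarrow> 'r set \<Rightarrow> ('n \<times> 'r) set monoid"
  where "loc_group act T =
    \<lparr>carrier = {loc_frac act T m x | m x. x \<in> T},
     monoid.mult = (\<lambda>A B. \<Union>(m, x)\<in>A. \<Union>(m', x')\<in>B. loc_frac act T (act x' m + act x m') (x * x')),
     one = loc_frac act T 0 1\<rparr>"

text \<open>
  Operations on classes of fractions are unions over all representatives; this evaluates them on
  chosen representatives once the result is known to be independent of the choice.
\<close>

lemma UN_pair_const: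
  assumes "(a, b) \<in> A" and "\<And>a' b'. (a', b') \<in> A \<Longrightarrow> g a' b' = C"
  shows "(\<Union>(a', b')\<in>A. g a' b') = C"
  using assms by fastforce

locale localization = module act
  for act :: "'r::comm_ring_1 \<Rightarrow> 'n::ab_group_add \<Rightarrow> 'n" +
  fixes T :: "'r set"
  assumes one_mem: "1 \<in> T" and mult_mem: "x \<in> T \<Longrightarrow> y \<in> T \<Longrightarrow> x * y \<in> T"
begin

abbreviation eq where "eq \<equiv> loc_eq act T"
abbreviation frac where "frac \<equiv> loc_frac act T"

lemma eqI1:
  assumes "act x' m = act x m'"
  shows "eq m x m' x'"
  unfolding loc_eq_def using one_mem assms by (intro bexI[of _ 1]) simp_all

lemma eq_sym:
  assumes "eq m x m' x'"
  shows "eq m' x' m x"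
proof -
  obtain u where u: "u \<in> T" "act u (act x' m - act x m') = 0" using assms by (auto simp: loc_eq_def)
  have "act u (act x m' - act x' m) = - act u (act x' m - act x m')"
    by (simp add: scale_right_diff_distrib)
  then show ?thesis unfolding loc_eq_def using u by auto
qed

lemma eq_trans:
  assumes "eq m x m' x'" "eq m' x' m'' x''" "x' \<in> T"
  shows "eq m x m'' x''"
proof -
  obtain u v where u: "u \<in> T" "act u (act x' m - act x m') = 0"
    and v: "v \<in> T" "act v (act x'' m' - act x' m'') = 0" using assms by (auto simp: loc_eq_def)
  have "act (u * v * x') (act x'' m - act x m'')
    = act (v * x'') (act u (act x' m - act x m')) + act (u * x) (act v (act x'' m' - act x' m''))"
    by (simp add: scale_right_diff_distrib mult_ac)
  then have "act (u * v * x') (act x'' m - act x m'') = 0" by (simp only: u v scale_zero_right add_0)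
  then show ?thesis unfolding loc_eq_def using u v assms(3) mult_mem by blast
qed

lemma frac_eq_iff:
  assumes "x \<in> T" "x' \<in> T"
  shows "frac m x = frac m' x' \<longleftrightarrow> eq m x m' x'"
proof
  assume "frac m x = frac m' x'"
  moreover have "(m', x') \<in> frac m' x'"
    unfolding loc_frac_def using assms eqI1[of x' m' x' m'] by simp
  ultimately show "eq m x m' x'" by (auto simp: loc_frac_def)
next
  assume "eq m x m' x'"
  then show "frac m x = frac m' x'"
    unfolding loc_frac_def using assms by (auto intro: eq_trans eq_sym)
qed

lemma mem_frac: "x \<in> T \<Longrightarrow> (m, x) \<in> frac m x"
  unfolding loc_frac_def using eqI1[of x m x m] by simp

lemma eq_add:
  assumes "eq m x m1 x1" "eq m' x' m1' x1'"
  shows "eq (act x' m + act x m') (x * x') (act x1' m1 + act x1 m1') (x1 * x1')"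
proof -
  obtain u v where u: "u \<in> T" "act u (act x1 m - act x m1) = 0"
    and v: "v \<in> T" "act v (act x1' m' - act x' m1') = 0" using assms by (auto simp: loc_eq_def)
  have "act (u * v) (act (x1 * x1') (act x' m + act x m') - act (x * x') (act x1' m1 + act x1 m1'))
    = act (v * x1' * x') (act u (act x1 m - act x m1))
      + act (u * x1 * x) (act v (act x1' m' - act x' m1'))"
    by (simp add: scale_right_diff_distrib scale_right_distrib mult_ac)
  then have "act (u * v) (act (x1 * x1') (act x' m + act x m')
      - act (x * x') (act x1' m1 + act x1 m1')) = 0"
    by (simp only: u v scale_zero_right add_0)
  then show ?thesis unfolding loc_eq_def using u v mult_mem by blast
qed

lemma eq_smult:
  assumes "loc_eq (*) T r z r1 z1" "eq m x m1 x1"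
  shows "eq (act r m) (z * x) (act r1 m1) (z1 * x1)"
proof -
  obtain w u where w: "w \<in> T" "w * (z1 * r - z * r1) = 0"
    and u: "u \<in> T" "act u (act x1 m - act x m1) = 0" using assms by (auto simp: loc_eq_def)
  \<comment> \<open>Change \<open>m / x\<close> first and \<open>r / z\<close> afterwards.\<close>
  have "act (w * u) (act (z1 * x1) (act r m) - act (z * x) (act r1 m1))
    = act (w * z1 * r) (act u (act x1 m - act x m1)) + act (u * x) (act (w * (z1 * r - z * r1)) m1)"
    by (simp add: scale_right_diff_distrib scale_left_diff_distrib right_diff_distrib mult_ac)
  then have "act (w * u) (act (z1 * x1) (act r m) - act (z * x) (act r1 m1)) = 0"
    by (simp only: u w scale_zero_right scale_zero_left add_0)
  then show ?thesis unfolding loc_eq_def using u w mult_mem by blast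
qed

lemma mult_frac:
  assumes "x \<in> T" "x' \<in> T"
  shows "frac m x \<otimes>\<^bsub>loc_group act T\<^esub> frac m' x' = frac (act x' m + act x m') (x * x')"
proof -
  have "frac (act x1' m1 + act x1 m1') (x1 * x1') = frac (act x' m + act x m') (x * x')"
    if 1: "(m1, x1) \<in> frac m x" and 2: "(m1', x1') \<in> frac m' x'" for m1 x1 m1' x1'
  proof -
    have "x1 \<in> T" "x1' \<in> T" "eq m x m1 x1" "eq m' x' m1' x1'"
      using 1 2 by (auto simp: loc_frac_def)
    then show ?thesis
      using eq_sym[OF eq_add] assms mult_mem by (simp add: frac_eq_iff)
  qed
  then show ?thesis
    unfolding loc_group_def
    by (simp add: UN_pair_const[OF mem_frac[OF assms(1)]] UN_pair_const[OF mem_frac[OF assms(2)]])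
qed

lemma frac_carrier: "x \<in> T \<Longrightarrow> frac m x \<in> carrier (loc_group act T)"
  by (auto simp: loc_group_def)

lemma carrier_cases:
  assumes "A \<in> carrier (loc_group act T)"
  obtains m x where "x \<in> T" "A = frac m x"
  using assms by (auto simp: loc_group_def)

lemma comm_group_loc_group: "comm_group (loc_group act T)"
proof (rule comm_groupI)
  show "\<one>\<^bsub>loc_group act T\<^esub> \<in> carrier (loc_group act T)"
    using one_mem by (auto simp: loc_group_def)
next
  fix A B assume "A \<in> carrier (loc_group act T)" "B \<in> carrier (loc_group act T)"
  then obtain m x m' x' where x: "x \<in> T" "A = frac m x" "x' \<in> T" "B = frac m' x'"
    by (metis carrier_cases)
  then show "A \<otimes>\<^bsub>loc_group act T\<^esub> B \<in> carrier (loc_group act T)"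
    by (simp add: mult_frac frac_carrier mult_mem)
  show "A \<otimes>\<^bsub>loc_group act T\<^esub> B = B \<otimes>\<^bsub>loc_group act T\<^esub> A"
    using x by (simp add: mult_frac add.commute mult.commute)
next
  fix A B C
  assume "A \<in> carrier (loc_group act T)" "B \<in> carrier (loc_group act T)" "C \<in> carrier (loc_group act T)"
  then obtain m x m' x' m'' x'' where x: "x \<in> T" "A = frac m x" "x' \<in> T" "B = frac m' x'"
    "x'' \<in> T" "C = frac m'' x''"
    by (metis carrier_cases)
  then show "A \<otimes>\<^bsub>loc_group act T\<^esub> B \<otimes>\<^bsub>loc_group act T\<^esub> C
      = A \<otimes>\<^bsub>loc_group act T\<^esub> (B \<otimes>\<^bsub>loc_group act T\<^esub> C)"
    by (simp add: mult_frac mult_mem scale_right_distrib mult_ac add_ac)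
next
  fix A assume "A \<in> carrier (loc_group act T)"
  then obtain m x where x: "x \<in> T" "A = frac m x" by (metis carrier_cases)
  have one: "\<one>\<^bsub>loc_group act T\<^esub> = frac 0 1" by (simp add: loc_group_def)
  show "\<one>\<^bsub>loc_group act T\<^esub> \<otimes>\<^bsub>loc_group act T\<^esub> A = A"
    using x one_mem by (simp add: one mult_frac)
  have "frac (- m) x \<otimes>\<^bsub>loc_group act T\<^esub> A = \<one>\<^bsub>loc_group act T\<^esub>"
    using x one_mem by (simp add: one mult_frac frac_eq_iff mult_mem eqI1)
  then show "\<exists>B\<in>carrier (loc_group act T). B \<otimes>\<^bsub>loc_group act T\<^esub> A = \<one>\<^bsub>loc_group act T\<^esub>"
    using frac_carrier[OF x(1)] by blast
qed

end

section \<open>Sheaves associated to graded modules\<close>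

lemma sections_associated_local:
  assumes "a \<in> sections (associated_sheaf S act N) U" "p \<in> U"
  obtains V m n x where "openin (Proj_topology S) V" "p \<in> V" "V \<subseteq> U" "m \<in> N n" "x \<in> S n"
    "\<forall>q\<in>V. x \<notin> q" "\<forall>q\<in>V. a q = fraction S act N q m x"
proof -
  have "\<exists>V n m x. openin (Proj_topology S) V \<and> p \<in> V \<and> V \<subseteq> U \<and> m \<in> N n \<and> x \<in> S n \<and>
        (\<forall>q\<in>V. x \<notin> q \<and> a q = fraction S act N q m x)"
    using assms unfolding associated_sheaf_def by simp
  then obtain V n m x where "openin (Proj_topology S) V" "p \<in> V" "V \<subseteq> U" "m \<in> N n" "x \<in> S n"
    and V: "\<forall>q\<in>V. x \<notin> q \<and> a q = fraction S act N q m x" by (elim exE conjE)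
  then show ?thesis using V by (intro that[of V m n x]) simp_all
qed

lemma sections_associatedI:
  assumes "a \<in> extensional U"
    and local: "\<And>p. p \<in> U \<Longrightarrow> \<exists>V n m x. openin (Proj_topology S) V \<and> p \<in> V \<and> V \<subseteq> U \<and>
      m \<in> N n \<and> x \<in> S n \<and> (\<forall>q\<in>V. x \<notin> q \<and> a q = fraction S act N q m x)"
  shows "a \<in> sections (associated_sheaf S act N) U"
proof -
  have "a p \<in> homogeneous_fractions S N p // fraction_rel S act N p" if "p \<in> U" for p
  proof -
    obtain n m x where "m \<in> N n" "x \<in> S n" "x \<notin> p" "a p = fraction S act N p m x"
      using local \<open>p \<in> U\<close> by meson
    then show ?thesis
      unfolding fraction_def homogeneous_fractions_def by (auto intro!: quotientI)
  qed
  then show ?thesis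
    unfolding associated_sheaf_def using assms by (auto simp: PiE_def)
qed

lemma section_local_fraction:
  assumes "a \<in> sections (associated_sheaf S act N) U" "p \<in> U"
  obtains m x where "(m, x) \<in> homogeneous_fractions S N p" "a p = fraction S act N p m x"
proof -
  obtain V n m x where "p \<in> V" "m \<in> N n" "x \<in> S n"
    "\<forall>q\<in>V. x \<notin> q" "\<forall>q\<in>V. a q = fraction S act N q m x"
    by (rule sections_associated_local[OF assms])
  then show ?thesis using that[of m x] by (auto simp: homogeneous_fractions_def)
qed

lemma restrict_section:
  assumes "openin (Proj_topology S) V" "V \<subseteq> U" "a \<in> sections (associated_sheaf S act N) U"
  shows "restrict a V \<in> sections (associated_sheaf S act N) V"
proof (rule sections_associatedI)
  fix p assume p: "p \<in> V"
  then have "p \<in> U" using assms(2) by blast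
  obtain W n m x where W: "openin (Proj_topology S) W" "p \<in> W" "W \<subseteq> U" "m \<in> N n" "x \<in> S n"
    "\<forall>q\<in>W. x \<notin> q" "\<forall>q\<in>W. a q = fraction S act N q m x"
    by (rule sections_associated_local[OF assms(3) \<open>p \<in> U\<close>])
  show "\<exists>V' n m x. openin (Proj_topology S) V' \<and> p \<in> V' \<and> V' \<subseteq> V \<and>
      m \<in> N n \<and> x \<in> S n \<and> (\<forall>q\<in>V'. x \<notin> q \<and> restrict a V q = fraction S act N q m x)"
    using W assms(1) p
    by (intro exI[of _ "W \<inter> V"] exI[of _ n] exI[of _ m] exI[of _ x]) (auto intro: openin_Int)
qed auto

lemma const_section:
  assumes "openin (Proj_topology S) U" "m \<in> N n" "x \<in> S n" "\<And>q. q \<in> U \<Longrightarrow> x \<notin> q"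
  shows "(\<lambda>q\<in>U. fraction S act N q m x) \<in> sections (associated_sheaf S act N) U"
proof (rule sections_associatedI)
  fix p assume p: "p \<in> U"
  show "\<exists>V n' m' x'. openin (Proj_topology S) V \<and> p \<in> V \<and> V \<subseteq> U \<and> m' \<in> N n' \<and> x' \<in> S n' \<and>
      (\<forall>q\<in>V. x' \<notin> q \<and> (\<lambda>q\<in>U. fraction S act N q m x) q = fraction S act N q m' x')"
    using assms p
    by (intro exI[of _ U] exI[of _ n] exI[of _ m] exI[of _ x]) auto
qed auto

text \<open>
  The stalk at \<open>p\<close> embeds in the localization of the whole ambient module at this set, so that
  equality in the stalk can be handled in a localization, where the degrees no longer matter.
\<close>

definition outside :: "(nat \<Rightarrow> 'r set) \<Rightarrow> 'r set \<Rightarrow> 'r set"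
  where "outside S p = (\<Union>n. S n) - p"

locale graded_ring =
  fixes S :: "nat \<Rightarrow> 'r::comm_ring_1 set"
  assumes S_zero: "0 \<in> S n"
    and S_one: "1 \<in> S 0"
    and S_add: "a \<in> S n \<Longrightarrow> b \<in> S n \<Longrightarrow> a + b \<in> S n"
    and S_mult: "a \<in> S m \<Longrightarrow> b \<in> S n \<Longrightarrow> a * b \<in> S (m + n)"
begin

lemma open_Proj: "openin (Proj_topology S) = Proj_open S"
  using S_zero S_mult by (rule openin_Proj_topology)

lemma open_subset_points: "openin (Proj_topology S) U \<Longrightarrow> U \<subseteq> Proj_points S"
  by (auto simp: open_Proj Proj_open_def)

lemma open_basic: "a \<in> S n \<Longrightarrow> openin (Proj_topology S) {p \<in> Proj_points S. a \<notin> p}"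
  unfolding open_Proj Proj_open_def by (intro exI[of _ "{a}"]) auto

lemma one_notin_point: "p \<in> Proj_points S \<Longrightarrow> 1 \<notin> p"
  by (simp add: Proj_points_def homogeneous_prime_def)

lemma point_prime:
  assumes "p \<in> Proj_points S" "a \<in> S m" "b \<in> S n" "a * b \<in> p"
  shows "a \<in> p \<or> b \<in> p"
proof -
  have "a \<in> graded_total S" "b \<in> graded_total S"
    using homogeneous_in_total[of S] S_zero assms(2,3) by blast+
  then show ?thesis using assms(1,4) unfolding Proj_points_def homogeneous_prime_def by blast
qed

lemma power_notin_point:
  assumes "p \<in> Proj_points S" "a \<in> S m" "a \<notin> p"
  shows "a ^ n \<in> S (n * m) \<and> a ^ n \<notin> p"
proof (induction n)
  case 0
  then show ?case using S_one one_notin_point[OF assms(1)] by simp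
next
  case (Suc n)
  then show ?case
    using S_mult[OF assms(2), of "a ^ n" "n * m"] point_prime[OF assms(1,2), of "a ^ n"] assms(3)
    by auto
qed

lemma outside_mult:
  assumes "p \<in> Proj_points S" "a \<in> outside S p" "b \<in> outside S p"
  shows "a * b \<in> outside S p"
proof -
  obtain m n where "a \<in> S m" "a \<notin> p" "b \<in> S n" "b \<notin> p" using assms(2,3) by (auto simp: outside_def)
  then show ?thesis
    using point_prime[OF assms(1), of a m b n] S_mult[of a m b n] by (auto simp: outside_def)
qed

lemma localization_outside:
  assumes "module act" "p \<in> Proj_points S"
  shows "localization act (outside S p)"
proof -
  have "1 \<in> outside S p"
    using S_one one_notin_point[OF assms(2)] by (auto simp: outside_def)
  then show ?thesis
    using assms outside_mult by (simp add: localization_def localization_axioms_def)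
qed

end

locale graded_module = graded_ring S + module act
  for S :: "nat \<Rightarrow> 'r::comm_ring_1 set" and act :: "'r \<Rightarrow> 'n::ab_group_add \<Rightarrow> 'n" +
  fixes N :: "nat \<Rightarrow> 'n set"
  assumes N_add: "m \<in> N n \<Longrightarrow> m' \<in> N n \<Longrightarrow> m + m' \<in> N n"
    and N_act: "x \<in> S k \<Longrightarrow> m \<in> N n \<Longrightarrow> act x m \<in> N (k + n)"
begin

abbreviation fr where "fr \<equiv> fraction S act N"
abbreviation hf where "hf \<equiv> homogeneous_fractions S N"
abbreviation sheaf where "sheaf \<equiv> associated_sheaf S act N"

lemma mem_fr:
  "(m', x') \<in> fr p m x \<longleftrightarrow>
    (m, x) \<in> hf p \<and> (m', x') \<in> hf p \<and> loc_eq act (outside S p) m x m' x'"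
  unfolding fraction_def fraction_rel_def loc_eq_def outside_def by auto

lemma hf_outside: "(m, x) \<in> hf p \<Longrightarrow> x \<in> outside S p"
  by (auto simp: homogeneous_fractions_def outside_def)

lemma fr_refl:
  assumes "p \<in> Proj_points S" "(m, x) \<in> hf p"
  shows "(m, x) \<in> fr p m x"
proof -
  interpret localization act "outside S p"
    by (rule localization_outside[OF module_axioms assms(1)])
  show ?thesis using assms(2) eqI1[of x m x m] by (simp add: mem_fr)
qed

lemma fr_eq_iff:
  assumes "p \<in> Proj_points S" "(m, x) \<in> hf p" "(m', x') \<in> hf p"
  shows "fr p m x = fr p m' x' \<longleftrightarrow> loc_eq act (outside S p) m x m' x'"
proof -
  interpret L: localization act "outside S p"
    by (rule localization_outside[OF module_axioms assms(1)])
  show ?thesis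
  proof
    assume "fr p m x = fr p m' x'"
    then have "(m', x') \<in> fr p m x" using fr_refl[OF assms(1,3)] by simp
    then show "L.eq m x m' x'" by (simp add: mem_fr)
  next
    assume e: "L.eq m x m' x'"
    have "(m1, x1) \<in> fr p m x \<longleftrightarrow> (m1, x1) \<in> fr p m' x'" for m1 x1
      using L.eq_trans[OF e _ hf_outside[OF assms(3)], of m1 x1]
        L.eq_trans[OF L.eq_sym[OF e] _ hf_outside[OF assms(2)], of m1 x1] assms(2,3)
      by (auto simp: mem_fr)
    then show "fr p m x = fr p m' x'" by auto
  qed
qed

lemma hf_add:
  assumes "p \<in> Proj_points S" "(m, x) \<in> hf p" "(m', x') \<in> hf p"
  shows "(act x' m + act x m', x * x') \<in> hf p"
proof -
  obtain n n' where n: "m \<in> N n" "x \<in> S n" "x \<notin> p" "m' \<in> N n'" "x' \<in> S n'" "x' \<notin> p"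
    using assms by (auto simp: homogeneous_fractions_def)
  have "act x' m + act x m' \<in> N (n + n')"
    using N_act[OF n(5,1)] N_act[OF n(2,4)] N_add by (simp add: add.commute)
  moreover have "x * x' \<in> S (n + n')" using S_mult n by blast
  moreover have "x * x' \<notin> p" using point_prime[OF assms(1)] n by blast
  ultimately show ?thesis by (auto simp: homogeneous_fractions_def)
qed

lemma hf_smult:
  assumes "p \<in> Proj_points S" "(r, z) \<in> homogeneous_fractions S S p" "(m, x) \<in> hf p"
  shows "(act r m, z * x) \<in> hf p"
proof -
  obtain n n' where n: "m \<in> N n" "x \<in> S n" "x \<notin> p" "r \<in> S n'" "z \<in> S n'" "z \<notin> p"
    using assms by (auto simp: homogeneous_fractions_def)
  have "z * x \<notin> p" using point_prime[OF assms(1)] n by blast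
  then show ?thesis using N_act[OF n(4,1)] S_mult[OF n(5,2)] by (auto simp: homogeneous_fractions_def)
qed

lemma stalk_add_fr:
  assumes "p \<in> Proj_points S" "(m, x) \<in> hf p" "(m', x') \<in> hf p"
  shows "stalk_add sheaf p (fr p m x) (fr p m' x') = fr p (act x' m + act x m') (x * x')"
proof -
  interpret L: localization act "outside S p"
    by (rule localization_outside[OF module_axioms assms(1)])
  have "fr p (act x1' m1 + act x1 m1') (x1 * x1') = fr p (act x' m + act x m') (x * x')"
    if "(m1, x1) \<in> fr p m x" "(m1', x1') \<in> fr p m' x'" for m1 x1 m1' x1'
    using that assms L.eq_sym[OF L.eq_add, of m x m1 x1 m' x' m1' x1']
    by (subst fr_eq_iff[OF assms(1)]) (auto simp: mem_fr intro: hf_add)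
  then show ?thesis
    unfolding associated_sheaf_def
    by (simp add: UN_pair_const[OF fr_refl[OF assms(1,2)]] UN_pair_const[OF fr_refl[OF assms(1,3)]])
qed

lemma graded_module_ring: "graded_module S (*) S"
  using S_add S_mult
  by (simp add: graded_module_def graded_module_axioms_def graded_ring_axioms module_mult)

lemma stalk_smult_fr:
  assumes "p \<in> Proj_points S" "(r, z) \<in> homogeneous_fractions S S p" "(m, x) \<in> hf p"
  shows "stalk_smult sheaf p (fraction S (*) S p r z) (fr p m x) = fr p (act r m) (z * x)"
proof -
  interpret L: localization act "outside S p"
    by (rule localization_outside[OF module_axioms assms(1)])
  interpret R: graded_module S "(*)" S by (rule graded_module_ring)
  have "fr p (act r1 m1) (z1 * x1) = fr p (act r m) (z * x)"
    if "(r1, z1) \<in> R.fr p r z" "(m1, x1) \<in> fr p m x" for r1 z1 m1 x1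
    using that assms L.eq_sym[OF L.eq_smult, of r z r1 z1 m x m1 x1]
    by (subst fr_eq_iff[OF assms(1)]) (auto simp: mem_fr R.mem_fr intro: hf_smult)
  then show ?thesis
    unfolding associated_sheaf_def
    by (simp add: UN_pair_const[OF R.fr_refl[OF assms(1,2)]] UN_pair_const[OF fr_refl[OF assms(1,3)]])
qed

lemma add_section:
  assumes U: "openin (Proj_topology S) U" and a: "a \<in> sections sheaf U" "a' \<in> sections sheaf U"
  shows "section_add sheaf U a a' \<in> sections sheaf U"
proof (rule sections_associatedI)
  fix p assume p: "p \<in> U"
  obtain V n m x where V: "openin (Proj_topology S) V" "p \<in> V" "V \<subseteq> U" "m \<in> N n" "x \<in> S n"
    "\<forall>q\<in>V. x \<notin> q" "\<forall>q\<in>V. a q = fr q m x"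
    by (rule sections_associated_local[OF a(1) p])
  obtain V' n' m' x' where V': "openin (Proj_topology S) V'" "p \<in> V'" "V' \<subseteq> U" "m' \<in> N n'" "x' \<in> S n'"
    "\<forall>q\<in>V'. x' \<notin> q" "\<forall>q\<in>V'. a' q = fr q m' x'"
    by (rule sections_associated_local[OF a(2) p])
  have "x * x' \<notin> q \<and> section_add sheaf U a a' q = fr q (act x' m + act x m') (x * x')"
    if q: "q \<in> V \<inter> V'" for q
  proof -
    have qp: "q \<in> Proj_points S" using open_subset_points[OF U] q V(3) by blast
    have hf: "(m, x) \<in> hf q" "(m', x') \<in> hf q"
      using q V V' by (auto simp: homogeneous_fractions_def)
    have "section_add sheaf U a a' q = stalk_add sheaf q (a q) (a' q)"
      using q V(3) by (auto simp: section_add_def)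
    moreover have "x * x' \<notin> q"
      using hf_add[OF qp hf] by (auto simp: homogeneous_fractions_def)
    ultimately show ?thesis using q V(7) V'(7) stalk_add_fr[OF qp hf] by simp
  qed
  moreover have "act x' m + act x m' \<in> N (n + n')"
    using N_act[OF V'(5) V(4)] N_act[OF V(5) V'(4)] N_add by (simp add: add.commute)
  ultimately show "\<exists>V n m x. openin (Proj_topology S) V \<and> p \<in> V \<and> V \<subseteq> U \<and> m \<in> N n \<and> x \<in> S n \<and>
      (\<forall>q\<in>V. x \<notin> q \<and> section_add sheaf U a a' q = fr q m x)"
    using V V' S_mult[OF V(5) V'(5)]
    by (intro exI[of _ "V \<inter> V'"] exI[of _ "n + n'"] exI[of _ "act x' m + act x m'"] exI[of _ "x * x'"])
      (auto intro: openin_Int)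
qed (simp add: section_add_def)

lemma smult_section:
  assumes U: "openin (Proj_topology S) U" and r: "r \<in> sections (Proj_structure_sheaf S) U"
    and a: "a \<in> sections sheaf U"
  shows "section_smult sheaf U r a \<in> sections sheaf U"
proof (rule sections_associatedI)
  fix p assume p: "p \<in> U"
  obtain V n m x where V: "openin (Proj_topology S) V" "p \<in> V" "V \<subseteq> U" "m \<in> N n" "x \<in> S n"
    "\<forall>q\<in>V. x \<notin> q" "\<forall>q\<in>V. a q = fr q m x"
    by (rule sections_associated_local[OF a p])
  obtain V' n' m' x' where V': "openin (Proj_topology S) V'" "p \<in> V'" "V' \<subseteq> U" "m' \<in> S n'" "x' \<in> S n'"
    "\<forall>q\<in>V'. x' \<notin> q" "\<forall>q\<in>V'. r q = fraction S (*) S q m' x'"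
    by (rule sections_associated_local[OF r[unfolded Proj_structure_sheaf_def] p])
  have "x' * x \<notin> q \<and> section_smult sheaf U r a q = fr q (act m' m) (x' * x)"
    if q: "q \<in> V \<inter> V'" for q
  proof -
    have qp: "q \<in> Proj_points S" using open_subset_points[OF U] q V(3) by blast
    have hf: "(m, x) \<in> hf q" "(m', x') \<in> homogeneous_fractions S S q"
      using q V V' by (auto simp: homogeneous_fractions_def)
    have "section_smult sheaf U r a q = stalk_smult sheaf q (r q) (a q)"
      using q V(3) by (auto simp: section_smult_def)
    moreover have "x' * x \<notin> q"
      using hf_smult[OF qp hf(2,1)] by (auto simp: homogeneous_fractions_def)
    ultimately show ?thesis using q V(7) V'(7) stalk_smult_fr[OF qp hf(2,1)] by simp
  qed
  then show "\<exists>V n m x. openin (Proj_topology S) V \<and> p \<in> V \<and> V \<subseteq> U \<and> m \<in> N n \<and> x \<in> S n \<and>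
      (\<forall>q\<in>V. x \<notin> q \<and> section_smult sheaf U r a q = fr q m x)"
    using V V' N_act[OF V'(4) V(4)] S_mult[OF V'(5) V(5)]
    by (intro exI[of _ "V \<inter> V'"] exI[of _ "n' + n"] exI[of _ "act m' m"] exI[of _ "x' * x"])
      (auto intro: openin_Int)
qed (simp add: section_smult_def)

lemma tensor_data_Proj:
  assumes "graded_module S (*) N'"
  shows "tensor_data (Proj_topology S) (Proj_structure_sheaf S) sheaf (associated_sheaf S (*) N')"
proof -
  interpret G: graded_module S "(*)" N' by fact
  show ?thesis
  proof
    show "restrict r V \<in> sections (Proj_structure_sheaf S) V"
      if "openin (Proj_topology S) V" "V \<subseteq> U" "r \<in> sections (Proj_structure_sheaf S) U" for U V r
      using restrict_section[OF that(1,2)] that(3) by (simp add: Proj_structure_sheaf_def)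
  qed (auto intro: restrict_section add_section smult_section G.add_section G.smult_section)
qed

text \<open>
  Multiplication of fractions, \<open>(m / x, r / z) \<mapsto> (r m) / (z x)\<close>, is balanced and biadditive, so
  pure tensors that agree near \<open>p\<close> have equal products in the localization at \<open>p\<close>.
\<close>

lemma loc_eq_if_tensor_eq:
  assumes N': "graded_module S (*) N'"
    and V: "openin (Proj_topology S) V" "p \<in> V"
    and a: "a \<in> sections sheaf V" "a' \<in> sections sheaf V"
    and b: "b \<in> sections (associated_sheaf S (*) N') V"
    and eq: "tensor_class (Proj_structure_sheaf S) sheaf (associated_sheaf S (*) N') V (frag_of (a, b))
      = tensor_class (Proj_structure_sheaf S) sheaf (associated_sheaf S (*) N') V (frag_of (a', b))"
    and am: "(m, x) \<in> hf p" "a p = fr p m x" and am': "(m', x') \<in> hf p" "a' p = fr p m' x'"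
    and br: "(r, z) \<in> homogeneous_fractions S N' p" "b p = fraction S (*) N' p r z"
  shows "loc_eq act (outside S p) (act r m) (z * x) (act r m') (z * x')"
proof -
  have p: "p \<in> Proj_points S" using open_subset_points[OF V(1)] V(2) by blast
  interpret L: localization act "outside S p"
    by (rule localization_outside[OF module_axioms p])
  interpret G: graded_module S "(*)" N' by fact
  interpret R: graded_module S "(*)" S by (rule graded_module_ring)
  interpret T: tensor_data "Proj_topology S" "Proj_structure_sheaf S" sheaf G.sheaf
    by (rule tensor_data_Proj[OF N'])
  let ?H = "loc_group act (outside S p)"
  define \<beta> where "\<beta> = (\<lambda>(a, b). \<Union>(m, x)\<in>a p. \<Union>(r, z)\<in>b p. L.frac (act r m) (z * x))"
  have \<beta>: "\<beta> (a, b) = L.frac (act r m) (z * x)"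
    if "a p = fr p m x" "b p = G.fr p r z" "(m, x) \<in> hf p" "(r, z) \<in> G.hf p" for a b m x r z
  proof -
    have "L.frac (act r1 m1) (z1 * x1) = L.frac (act r m) (z * x)"
      if 1: "(m1, x1) \<in> fr p m x" "(r1, z1) \<in> G.fr p r z" for m1 x1 r1 z1
      using 1 L.eq_sym[OF L.eq_smult, of r z r1 z1 m x m1 x1] hf_outside G.hf_outside L.mult_mem
      by (subst L.frac_eq_iff) (auto simp: mem_fr G.mem_fr)
    then show ?thesis
      unfolding \<beta>_def
      by (simp add: that(1,2) UN_pair_const[OF fr_refl[OF p that(3)]] UN_pair_const[OF G.fr_refl[OF p that(4)]])
  qed
  have "\<beta> (a, b) = \<beta> (a', b)"
  proof (rule T.balanced_eqI[OF V(1) L.comm_group_loc_group])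
    fix a b assume ab: "a \<in> sections sheaf V" "b \<in> sections G.sheaf V"
    obtain m x where m: "(m, x) \<in> hf p" "a p = fr p m x"
      by (rule section_local_fraction[OF ab(1) V(2)])
    obtain r z where r: "(r, z) \<in> G.hf p" "b p = G.fr p r z"
      by (rule section_local_fraction[OF ab(2) V(2)])
    show "\<beta> (a, b) \<in> carrier ?H"
      using hf_outside[OF m(1)] G.hf_outside[OF r(1)] L.mult_mem
      by (simp add: \<beta>[of a m x b r z, OF m(2) r(2) m(1) r(1)] L.frac_carrier)
  next
    fix a a' b assume ab: "a \<in> sections sheaf V" "a' \<in> sections sheaf V" "b \<in> sections G.sheaf V"
    obtain m x where m: "(m, x) \<in> hf p" "a p = fr p m x"
      by (rule section_local_fraction[OF ab(1) V(2)])
    obtain m' x' where m': "(m', x') \<in> hf p" "a' p = fr p m' x'"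
      by (rule section_local_fraction[OF ab(2) V(2)])
    obtain r z where r: "(r, z) \<in> G.hf p" "b p = G.fr p r z"
      by (rule section_local_fraction[OF ab(3) V(2)])
    have sum: "section_add sheaf V a a' p = fr p (act x' m + act x m') (x * x')"
      using V(2) m(2) m'(2) stalk_add_fr[OF p m(1) m'(1)] by (simp add: section_add_def)
    have o: "x \<in> outside S p" "x' \<in> outside S p" "z \<in> outside S p"
      using m m' r hf_outside G.hf_outside by blast+
    show "\<beta> (section_add sheaf V a a', b) = \<beta> (a, b) \<otimes>\<^bsub>?H\<^esub> \<beta> (a', b)"
      unfolding \<beta>[of "section_add sheaf V a a'" _ _ b r z, OF sum r(2) hf_add[OF p m(1) m'(1)] r(1)] \<beta>[of a m x b r z, OF m(2) r(2) m(1) r(1)]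
        \<beta>[of a' m' x' b r z, OF m'(2) r(2) m'(1) r(1)]
      using o L.mult_mem
      by (simp add: L.mult_frac L.frac_eq_iff)
        (rule L.eqI1, simp add: scale_right_distrib mult_ac)
  next
    fix a b b' assume ab: "a \<in> sections sheaf V" "b \<in> sections G.sheaf V" "b' \<in> sections G.sheaf V"
    obtain m x where m: "(m, x) \<in> hf p" "a p = fr p m x"
      by (rule section_local_fraction[OF ab(1) V(2)])
    obtain r z where r: "(r, z) \<in> G.hf p" "b p = G.fr p r z"
      by (rule section_local_fraction[OF ab(2) V(2)])
    obtain r' z' where r': "(r', z') \<in> G.hf p" "b' p = G.fr p r' z'"
      by (rule section_local_fraction[OF ab(3) V(2)])
    have sum: "section_add G.sheaf V b b' p = G.fr p (z' * r + z * r') (z * z')"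
      using V(2) r(2) r'(2) G.stalk_add_fr[OF p r(1) r'(1)] by (simp add: section_add_def)
    have o: "x \<in> outside S p" "z' \<in> outside S p" "z \<in> outside S p"
      using m r r' hf_outside G.hf_outside by blast+
    show "\<beta> (a, section_add G.sheaf V b b') = \<beta> (a, b) \<otimes>\<^bsub>?H\<^esub> \<beta> (a, b')"
      unfolding \<beta>[of a m x "section_add G.sheaf V b b'", OF m(2) sum m(1) G.hf_add[OF p r(1) r'(1)]] \<beta>[of a m x b r z, OF m(2) r(2) m(1) r(1)]
        \<beta>[of a m x b' r' z', OF m(2) r'(2) m(1) r'(1)]
      using o L.mult_mem
      by (simp add: L.mult_frac L.frac_eq_iff)
        (rule L.eqI1, simp add: scale_left_distrib scale_right_distrib mult_ac)
  next
    fix t a b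
    assume ab: "t \<in> sections (Proj_structure_sheaf S) V" "a \<in> sections sheaf V" "b \<in> sections G.sheaf V"
    obtain k w where t: "(k, w) \<in> R.hf p" "t p = R.fr p k w"
      by (rule section_local_fraction[OF ab(1)[unfolded Proj_structure_sheaf_def] V(2)])
    obtain m x where m: "(m, x) \<in> hf p" "a p = fr p m x"
      by (rule section_local_fraction[OF ab(2) V(2)])
    obtain r z where r: "(r, z) \<in> G.hf p" "b p = G.fr p r z"
      by (rule section_local_fraction[OF ab(3) V(2)])
    have 1: "section_smult sheaf V t a p = fr p (act k m) (w * x)"
      using V(2) m(2) t(2) stalk_smult_fr[OF p t(1) m(1)] by (simp add: section_smult_def)
    have 2: "section_smult G.sheaf V t b p = G.fr p (k * r) (w * z)"
      using V(2) r(2) t(2) G.stalk_smult_fr[OF p t(1) r(1)] by (simp add: section_smult_def)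
    show "\<beta> (section_smult sheaf V t a, b) = \<beta> (a, section_smult G.sheaf V t b)"
      unfolding \<beta>[of "section_smult sheaf V t a" _ _ b r z, OF 1 r(2) hf_smult[OF p t(1) m(1)] r(1)]
        \<beta>[of a m x "section_smult G.sheaf V t b", OF m(2) 2 m(1) G.hf_smult[OF p t(1) r(1)]]
      by (simp add: mult_ac)
  qed (use a b eq in auto)
  then show ?thesis
    using hf_outside[OF am(1)] hf_outside[OF am'(1)] G.hf_outside[OF br(1)] L.mult_mem
    unfolding \<beta>[of a m x b r z, OF am(2) br(2) am(1) br(1)] \<beta>[of a' m' x' b r z, OF am'(2) br(2) am'(1) br(1)]
    by (simp add: L.frac_eq_iff)
qed

end

section \<open>Polynomials with coefficients in a module\<close>

lemma monom_sum_induct [case_names monom add]: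
  assumes "\<And>c n. P (monom c n)" and "\<And>p q. P p \<Longrightarrow> P q \<Longrightarrow> P (p + q)"
  shows "P (p :: 'b::ab_group_add poly)"
proof -
  have "P (\<Sum>i\<in>A. monom (coeff p i) i)" if "finite A" for A
    using that
  proof induction
    case empty
    then show ?case using assms(1)[of 0 0] by simp
  next
    case (insert i A)
    then show ?case using assms by simp
  qed
  from this[of "{..degree p}"] show ?thesis by (simp add: poly_as_sum_of_monoms)
qed

text \<open>
  Summation bounds that do not depend on the exact degrees make additivity visible: the degree of
  a sum can drop.
\<close>

lemma poly_scale_bounds:
  assumes "module scale" "degree p \<le> k" "degree q \<le> l"
  shows "poly_scale scale p q = (\<Sum>i\<le>k. \<Sum>j\<le>l. monom (scale (coeff p i) (coeff q j)) (i + j))"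
proof -
  interpret module scale by fact
  have inner: "(\<Sum>j\<le>degree q. monom (scale c (coeff q j)) (i + j))
    = (\<Sum>j\<le>l. monom (scale c (coeff q j)) (i + j))" for c i
    using assms(3) by (intro sum.mono_neutral_left) (auto simp: coeff_eq_0)
  have "poly_scale scale p q
    = (\<Sum>i\<le>degree p. \<Sum>j\<le>l. monom (scale (coeff p i) (coeff q j)) (i + j))"
    unfolding poly_scale_def inner ..
  also have "\<dots> = (\<Sum>i\<le>k. \<Sum>j\<le>l. monom (scale (coeff p i) (coeff q j)) (i + j))"
    using assms(2) by (intro sum.mono_neutral_left) (auto simp: coeff_eq_0)
  finally show ?thesis .
qed

lemma module_poly_scale:
  assumes "module scale"
  shows "module (poly_scale scale)"
proof -
  interpret module scale by fact
  have right: "poly_scale scale p (q + r) = poly_scale scale p q + poly_scale scale p r" for p q r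
  proof -
    let ?l = "max (degree q) (degree r)"
    have "degree (q + r) \<le> ?l" by (rule degree_add_le_max)
    then show ?thesis
      by (simp add: poly_scale_bounds[OF assms, of p "degree p" _ ?l] scale_right_distrib
          sum.distrib flip: add_monom)
  qed
  have left: "poly_scale scale (p + q) r = poly_scale scale p r + poly_scale scale q r" for p q r
  proof -
    let ?k = "max (degree p) (degree q)"
    have "degree (p + q) \<le> ?k" by (rule degree_add_le_max)
    then show ?thesis
      by (simp add: poly_scale_bounds[OF assms, of _ ?k r "degree r"] scale_left_distrib
          sum.distrib flip: add_monom)
  qed
  have assoc: "poly_scale scale p (poly_scale scale q r) = poly_scale scale (p * q) r" for p q r
  proof (induction p rule: monom_sum_induct)
    case (monom a i)
    show ?case
    proof (induction q rule: monom_sum_induct)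
      case (monom b j)
      show ?case
        by (induction r rule: monom_sum_induct)
          (simp_all add: right poly_scale_monom[OF assms] mult_monom add.assoc)
    qed (simp add: left right distrib_left)
  qed (simp add: left distrib_right)
  have one: "poly_scale scale 1 p = p" for p
  proof (induction p rule: monom_sum_induct)
    case (monom c n)
    have "(1 :: 'a poly) = monom 1 0" by (simp add: monom_0 one_pCons)
    then have "poly_scale scale 1 (monom c n) = poly_scale scale (monom 1 0) (monom c n)" by (rule arg_cong)
    also have "\<dots> = monom c n" unfolding poly_scale_monom[OF assms] by simp
    finally show ?case .
  qed (simp add: right)
  show ?thesis by standard (fact right left assoc one)+
qed

section \<open>Rees algebras and Rees modules\<close>

lemma monom_rees_ring: "c \<in> ideal_power I n \<Longrightarrow> monom c n \<in> rees_ring I n"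
  by (auto simp: rees_ring_def)

lemma graded_ring_rees: "graded_ring (rees_ring I)"
proof
  show "0 \<in> rees_ring I n" for n
    using monom_rees_ring[OF zero_ideal_power[of I n]] by simp
  show "a + b \<in> rees_ring I n" if "a \<in> rees_ring I n" "b \<in> rees_ring I n" for a b n
    using that ideal.subspace_add[OF ideal_ideal_power] by (auto simp: rees_ring_def add_monom)
  show "a * b \<in> rees_ring I (m + n)" if "a \<in> rees_ring I m" "b \<in> rees_ring I n" for m n a b
    using that ideal_power_mult by (auto simp: rees_ring_def mult_monom)
qed (rule one_rees_ring)

lemma graded_module_twist: "graded_module (rees_ring I) (*) (\<lambda>n. rees_ring I (n + s))"
proof -
  interpret graded_ring "rees_ring I" by (rule graded_ring_rees)
  show ?thesis
    using S_add S_mult module_mult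
    by (auto simp: graded_module_def graded_module_axioms_def graded_ring_axioms add.assoc)
qed

lemma graded_module_rees:
  assumes "module scale"
  shows "graded_module (rees_ring I) (poly_scale scale) (rees_module scale I)"
proof -
  interpret module scale by fact
  interpret graded_ring "rees_ring I" by (rule graded_ring_rees)
  have act: "scale c m \<in> ideal_times scale (ideal_power I (k + n)) UNIV"
    if c: "c \<in> ideal_power I k" and m: "m \<in> ideal_times scale (ideal_power I n) UNIV" for c m k n
  proof -
    let ?N = "ideal_times scale (ideal_power I (k + n)) UNIV"
    have N: "subspace ?N" by (simp add: ideal_times_def)
    have sub: "subspace {m. scale c m \<in> ?N}"
    proof (rule subspaceI)
      show "0 \<in> {m. scale c m \<in> ?N}" using subspace_0[OF N] by simp
      show "x + y \<in> {m. scale c m \<in> ?N}"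
        if "x \<in> {m. scale c m \<in> ?N}" "y \<in> {m. scale c m \<in> ?N}" for x y
        using that subspace_add[OF N] by (simp add: scale_right_distrib)
      show "scale b x \<in> {m. scale c m \<in> ?N}" if "x \<in> {m. scale c m \<in> ?N}" for b x
        using that subspace_scale[OF N] by (metis mem_Collect_eq scale_left_commute)
    qed
    have "{scale a m | a m. a \<in> ideal_power I n \<and> m \<in> UNIV} \<subseteq> {m. scale c m \<in> ?N}"
    proof clarify
      fix a m assume "a \<in> ideal_power I n"
      then have "scale (c * a) m \<in> ?N"
        unfolding ideal_times_def using ideal_power_mult[OF c] by (intro span_base) blast
      then show "scale c (scale a m) \<in> ?N" by simp
    qed
    from span_minimal[OF this sub] show ?thesis using m unfolding ideal_times_def by blast
  qed
  have add: "m + m' \<in> ideal_times scale (ideal_power I n) UNIV"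
    if "m \<in> ideal_times scale (ideal_power I n) UNIV"
      "m' \<in> ideal_times scale (ideal_power I n) UNIV" for m m' n
    using that unfolding ideal_times_def by (rule span_add)
  have "graded_module_axioms (rees_ring I) (poly_scale scale) (rees_module scale I)"
  proof
    show "m + m' \<in> rees_module scale I n"
      if "m \<in> rees_module scale I n" "m' \<in> rees_module scale I n" for m m' n
      using that add by (auto simp: rees_module_def add_monom)
    show "poly_scale scale x m \<in> rees_module scale I (k + n)"
      if "x \<in> rees_ring I k" "m \<in> rees_module scale I n" for x m k n
      using that act by (auto simp: rees_ring_def rees_module_def poly_scale_monom[OF assms])
  qed
  then show ?thesis
    by (simp add: graded_module_def graded_ring_axioms module_poly_scale[OF assms])
qed

text \<open>
  The blowup is covered by the standard charts \<open>D\<^sub>+(h t)\<close>: the irrelevant ideal of the Rees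
  algebra is generated in degree one.
\<close>

lemma point_in_chart:
  assumes y: "y \<in> Proj_points (rees_ring I)"
  shows "\<exists>h\<in>I. monom h 1 \<notin> y"
proof (rule ccontr)
  assume "\<not> ?thesis"
  then have h: "monom h 1 \<in> y" if "h \<in> I" for h using that by blast
  interpret graded_ring "rees_ring I" by (rule graded_ring_rees)
  have total: "a \<in> graded_total (rees_ring I)" if "a \<in> rees_ring I n" for a n
    using homogeneous_in_total[of "rees_ring I"] S_zero that by blast
  have y0: "0 \<in> y" and yadd: "a + b \<in> y" if "a \<in> y" "b \<in> y" for a b
    using y that by (auto simp: Proj_points_def homogeneous_prime_def)
  have ymult: "a * b \<in> y" if "a \<in> rees_ring I n" "b \<in> y" for a b n
    using y that total by (auto simp: Proj_points_def homogeneous_prime_def)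
  have "rees_ring I n \<subseteq> y" if "n > 0" for n
  proof -
    obtain k where n: "n = Suc k" using \<open>n > 0\<close> by (metis gr0_implies_Suc)
    have sub: "is_ideal {c. monom c n \<in> y}"
    proof (rule ideal.subspaceI)
      show "0 \<in> {c. monom c n \<in> y}" using y y0 by (simp add: Proj_points_def homogeneous_prime_def)
      show "c + d \<in> {c. monom c n \<in> y}"
        if "c \<in> {c. monom c n \<in> y}" "d \<in> {c. monom c n \<in> y}" for c d
        using that yadd[of "monom c n" "monom d n"] by (simp add: add_monom)
      show "b * c \<in> {c. monom c n \<in> y}" if "c \<in> {c. monom c n \<in> y}" for b c
        using that ymult[of "monom b 0" 0 "monom c n"] monom_rees_ring[of b I 0]
        by (simp add: mult_monom)
    qed
    have "{u * v | u v. u \<in> I \<and> v \<in> ideal_power I k} \<subseteq> {c. monom c n \<in> y}"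
    proof clarify
      fix u v assume uv: "u \<in> I" "v \<in> ideal_power I k"
      have "monom v k * monom u 1 \<in> y" using ymult[OF monom_rees_ring[OF uv(2)] h[OF uv(1)]] .
      then show "monom (u * v) n \<in> y" by (simp add: mult_monom n mult.commute)
    qed
    then have "ideal_power I n \<subseteq> {c. monom c n \<in> y}"
      unfolding n ideal_power.simps ideal_times_def using sub unfolding n by (rule ideal.span_minimal)
    then show ?thesis by (auto simp: rees_ring_def)
  qed
  then show False using y by (auto simp: Proj_points_def)
qed

lemma graded_total_rees: "p \<in> graded_total (rees_ring I) \<longleftrightarrow> (\<forall>i. coeff p i \<in> ideal_power I i)"
proof
  assume "p \<in> graded_total (rees_ring I)"
  then obtain g k where p: "p = (\<Sum>n\<le>k. g n)" "\<forall>n. g n \<in> rees_ring I n"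
    by (auto simp: graded_total_def)
  have "coeff (g n) i \<in> ideal_power I i" for n i
  proof -
    obtain c where "c \<in> ideal_power I n" "g n = monom c n" using p(2) by (auto simp: rees_ring_def)
    then show ?thesis using zero_ideal_power by auto
  qed
  then show "\<forall>i. coeff p i \<in> ideal_power I i"
    by (auto simp: p(1) coeff_sum intro!: ideal.subspace_sum[OF ideal_ideal_power])
next
  assume "\<forall>i. coeff p i \<in> ideal_power I i"
  then have "\<forall>i. monom (coeff p i) i \<in> rees_ring I i" using monom_rees_ring by blast
  moreover have "p = (\<Sum>i\<le>degree p. monom (coeff p i) i)" by (simp add: poly_as_sum_of_monoms)
  ultimately show "p \<in> graded_total (rees_ring I)" unfolding graded_total_def by blast
qed

text \<open>
  Polynomials with coefficients in a prime ideal form a prime ideal: look at the lowest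
  coefficients outside it.
\<close>

lemma poly_coeffs_prime:
  fixes a b :: "'a::comm_ring_1 poly"
  assumes q: "is_ideal q" "\<And>c d. c * d \<in> q \<Longrightarrow> c \<in> q \<or> d \<in> q"
    and ab: "\<forall>i. coeff (a * b) i \<in> q"
  shows "(\<forall>i. coeff a i \<in> q) \<or> (\<forall>i. coeff b i \<in> q)"
proof (rule ccontr)
  assume "\<not> ?thesis"
  then have ex: "\<exists>i. coeff a i \<notin> q" "\<exists>j. coeff b j \<notin> q" by auto
  define i where "i = (LEAST i. coeff a i \<notin> q)"
  define j where "j = (LEAST j. coeff b j \<notin> q)"
  have i_out: "coeff a i \<notin> q" unfolding i_def by (rule LeastI_ex[OF ex(1)])
  have i_below: "coeff a k \<in> q" if "k < i" for k
    using not_less_Least[OF that[unfolded i_def]] by simp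
  have j_out: "coeff b j \<notin> q" unfolding j_def by (rule LeastI_ex[OF ex(2)])
  have j_below: "coeff b k \<in> q" if "k < j" for k
    using not_less_Least[OF that[unfolded j_def]] by simp
  have "coeff a k * coeff b (i + j - k) \<in> q" if k: "k \<in> {..i + j} - {i}" for k
  proof (cases "k < i")
    case True
    then show ?thesis
      using ideal.subspace_scale[OF q(1) i_below, of k "coeff b (i + j - k)"] by (simp add: mult.commute)
  next
    case False
    then have "i + j - k < j" using k by auto
    from ideal.subspace_scale[OF q(1) j_below[OF this]] show ?thesis .
  qed
  then have rest: "(\<Sum>k\<in>{..i + j} - {i}. coeff a k * coeff b (i + j - k)) \<in> q"
    by (intro ideal.subspace_sum[OF q(1)])
  have "coeff (a * b) (i + j)
    = coeff a i * coeff b j + (\<Sum>k\<in>{..i + j} - {i}. coeff a k * coeff b (i + j - k))"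
    by (simp add: coeff_mult sum.remove[of _ i])
  then have "coeff a i * coeff b j
    = coeff (a * b) (i + j) - (\<Sum>k\<in>{..i + j} - {i}. coeff a k * coeff b (i + j - k))"
    by simp
  also have "\<dots> \<in> q" using ab rest by (intro ideal.subspace_diff[OF q(1)]) auto
  finally show False using q(2) i_out j_out by blast
qed

text \<open>
  The extension of \<open>q\<close> to the polynomial ring, cut down to the Rees algebra. It does not contain
  \<open>h t\<close>, so it is a point of the chart of \<open>h\<close>; these points suffice to detect which elements of
  \<open>M\<close> vanish there.
\<close>

lemma point_of_prime:
  fixes q :: "'a::comm_ring_1 set"
  assumes q: "is_ideal q" "\<And>c d. c * d \<in> q \<Longrightarrow> c \<in> q \<or> d \<in> q" "1 \<notin> q" and h: "h \<in> I" "h \<notin> q"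
  shows "{p \<in> graded_total (rees_ring I). \<forall>i. coeff p i \<in> q} \<in> Proj_points (rees_ring I)"
    (is "?y \<in> _")
proof -
  interpret graded_ring "rees_ring I" by (rule graded_ring_rees)
  note add = ideal.subspace_add[OF q(1)] ideal.subspace_add[OF ideal_ideal_power]
  have mult: "a * b \<in> ?y" if "a \<in> graded_total (rees_ring I)" "b \<in> ?y" for a b
  proof -
    have a: "coeff a i \<in> ideal_power I i" and b: "coeff b i \<in> ideal_power I i" "coeff b i \<in> q" for i
      using that by (auto simp: graded_total_rees)
    have "coeff (a * b) i \<in> ideal_power I i" for i
      unfolding coeff_mult
    proof (rule ideal.subspace_sum[OF ideal_ideal_power])
      fix k assume "k \<in> {..i}"
      then show "coeff a k * coeff b (i - k) \<in> ideal_power I i"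
        using ideal_power_mult[OF a[of k] b(1)[of "i - k"]] by simp
    qed
    moreover have "coeff (a * b) i \<in> q" for i
      unfolding coeff_mult by (intro ideal.subspace_sum[OF q(1)] ideal.subspace_scale[OF q(1)] b(2))
    ultimately show ?thesis by (simp add: graded_total_rees)
  qed
  have decomp: "\<exists>g k. (\<forall>n. g n \<in> rees_ring I n \<inter> ?y) \<and> a = (\<Sum>n\<le>k. g n)" if "a \<in> ?y" for a
  proof (intro exI conjI allI)
    show "a = (\<Sum>n\<le>degree a. monom (coeff a n) n)" by (simp add: poly_as_sum_of_monoms)
    fix n
    have "monom (coeff a n) n \<in> rees_ring I n"
      using that by (auto simp: graded_total_rees intro: monom_rees_ring)
    moreover have "monom (coeff a n) n \<in> ?y"
      using that zero_ideal_power ideal.subspace_0[OF q(1)] by (auto simp: graded_total_rees)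
    ultimately show "monom (coeff a n) n \<in> rees_ring I n \<inter> ?y" by blast
  qed
  have one: "1 \<notin> ?y"
  proof
    assume "1 \<in> ?y"
    then have "coeff (1 :: 'a poly) 0 \<in> q" by blast
    then show False using q(3) by simp
  qed
  have zero: "0 \<in> ?y"
    using zero_ideal_power[of I] ideal.subspace_0[OF q(1)] by (simp add: graded_total_rees)
  have plus: "a + b \<in> ?y" if "a \<in> ?y" "b \<in> ?y" for a b
    using that by (auto simp: graded_total_rees intro: add)
  have prime: "a \<in> ?y \<or> b \<in> ?y"
    if "a \<in> graded_total (rees_ring I)" "b \<in> graded_total (rees_ring I)" "a * b \<in> ?y" for a b
    using that poly_coeffs_prime[OF q(1,2), of a b] by auto
  have "homogeneous_prime (rees_ring I) ?y"
    unfolding homogeneous_prime_def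
  proof (intro conjI ballI impI)
    show "?y \<subseteq> graded_total (rees_ring I)" by (rule Collect_subset)
  qed (fact zero plus mult decomp one prime)+
  moreover have "\<not> rees_ring I 1 \<subseteq> ?y"
  proof
    assume "rees_ring I 1 \<subseteq> ?y"
    moreover have "monom h 1 \<in> rees_ring I 1"
      using power_in_ideal_power[OF h(1), of 1] by (intro monom_rees_ring) simp
    ultimately have "coeff (monom h 1) 1 \<in> q" by blast
    then show False using h(2) by simp
  qed
  ultimately show ?thesis unfolding Proj_points_def by fastforce
qed

section \<open>Regularity of the section on the blowup\<close>

lemma monom_power: "monom h 1 ^ k = monom (h ^ k) k"
  by (induction k) (simp_all add: mult_monom monom_0 one_pCons)

lemma chart_power_notin:
  assumes "y \<in> Proj_points (rees_ring I)" "h \<in> I" "monom h 1 \<notin> y"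
  shows "monom (h ^ k) k \<notin> y"
proof -
  interpret graded_ring "rees_ring I" by (rule graded_ring_rees)
  have "monom h 1 \<in> rees_ring I 1"
    using power_in_ideal_power[OF assms(2), of 1] by (intro monom_rees_ring) simp
  from power_notin_point[OF assms(1) this assms(3), of k] show ?thesis
    unfolding monom_power by blast
qed

text \<open>
  Near a point \<open>y\<close>, let \<open>m / x\<close> and \<open>m' / x'\<close> have the same product with the section. After
  clearing denominators this is an equation \<open>f w = 0\<close> in \<open>M\<close>. The hypothesis makes \<open>w\<close> torsion, and
  torsion dies at \<open>y\<close>: some \<open>h t\<close> with \<open>h \<in> I\<close> is invertible there.
\<close>

lemma regular_if_inj_mod_torsion:
  assumes M: "module scale" and f: "f \<in> ideal_power I s"
    and inj: "\<And>m. scale f m \<in> torsion scale I \<Longrightarrow> m \<in> torsion scale I"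
  shows "Proj_regular (rees_ring I) s (blowup_sheaf scale I) (alpha I s (monom f s))"
proof -
  interpret M: module scale by fact
  interpret graded_module "rees_ring I" "poly_scale scale" "rees_module scale I"
    by (rule graded_module_rees[OF M])
  interpret L: graded_module "rees_ring I" "(*)" "\<lambda>n. rees_ring I (n + s)"
    by (rule graded_module_twist)
  interpret T: tensor_data "Proj_topology (rees_ring I)" "Proj_structure_sheaf (rees_ring I)" sheaf L.sheaf
    by (rule tensor_data_Proj[OF graded_module_twist])
  let ?X = "Proj_topology (rees_ring I)" and ?\<sigma> = "alpha I s (monom f s)"
  have "inj_on (mult_section ?X (Proj_structure_sheaf (rees_ring I)) sheaf L.sheaf ?\<sigma> U)
    (sections sheaf U)" if U: "openin ?X U" for U
  proof (rule inj_onI)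
    fix a a' assume a: "a \<in> sections sheaf U" "a' \<in> sections sheaf U"
      and eq: "mult_section ?X (Proj_structure_sheaf (rees_ring I)) sheaf L.sheaf ?\<sigma> U a
        = mult_section ?X (Proj_structure_sheaf (rees_ring I)) sheaf L.sheaf ?\<sigma> U a'"
    have \<sigma>: "restrict ?\<sigma> V \<in> sections L.sheaf V" if "openin ?X V" for V
      using restrict_section[OF that open_subset_points[OF that]] alpha_global_section[OF f]
      by (simp add: twisting_sheaf_def)
    have "a y = a' y" if y: "y \<in> U" for y
    proof -
      obtain V where V: "openin ?X V" "y \<in> V" "V \<subseteq> U"
        "T.cls V (frag_of (restrict a V, restrict ?\<sigma> V))
          = T.cls V (frag_of (restrict a' V, restrict ?\<sigma> V))"
        using eq[unfolded T.mult_section_eq_iff[OF U a \<sigma>[OF U]]] y by blast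
      have p: "y \<in> Proj_points (rees_ring I)" using open_subset_points[OF U] y by blast
      obtain m x where m: "(m, x) \<in> hf y" "a y = fr y m x"
        by (rule section_local_fraction[OF a(1) y])
      obtain m' x' where m': "(m', x') \<in> hf y" "a' y = fr y m' x'"
        by (rule section_local_fraction[OF a(2) y])
      have F: "(monom f s, 1) \<in> L.hf y" "?\<sigma> y = L.fr y (monom f s) 1"
        using p monom_rees_ring[OF f] one_rees_ring one_notin_point[OF p]
        by (auto simp: homogeneous_fractions_def alpha_def intro!: exI[of _ 0])
      have "loc_eq (poly_scale scale) (outside (rees_ring I) y)
        (poly_scale scale (monom f s) m) (1 * x) (poly_scale scale (monom f s) m') (1 * x')"
        using V(2) m(2) m'(2) F(2)
        by (intro loc_eq_if_tensor_eq[OF graded_module_twist V(1,2)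
              restrict_section[OF V(1,3) a(1)] restrict_section[OF V(1,3) a(2)] \<sigma>[OF V(1)] V(4)
              m(1) _ m'(1) _ F(1)]) simp_all
      then obtain u where u: "u \<in> outside (rees_ring I) y"
        "poly_scale scale u (poly_scale scale x' (poly_scale scale (monom f s) m)
          - poly_scale scale x (poly_scale scale (monom f s) m')) = 0"
        by (auto simp: loc_eq_def)
      obtain n \<mu> \<xi> where n: "m = monom \<mu> n" "x = monom \<xi> n"
        using m(1) by (auto simp: homogeneous_fractions_def rees_module_def rees_ring_def)
      obtain n' \<mu>' \<xi>' where n': "m' = monom \<mu>' n'" "x' = monom \<xi>' n'"
        using m'(1) by (auto simp: homogeneous_fractions_def rees_module_def rees_ring_def)
      obtain c k where c: "u = monom c k" using u(1) by (auto simp: outside_def rees_ring_def)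
      \<comment> \<open>Pull the factor \<open>f\<close> out of the equation in the localization and read off coefficients.\<close>
      define w where "w = scale c (scale \<xi>' \<mu> - scale \<xi> \<mu>')"
      have uw: "poly_scale scale u (poly_scale scale x' m - poly_scale scale x m') = monom w (k + (n + n'))"
        by (simp add: n n' c w_def poly_scale_monom[OF M] diff_monom add.commute[of n' n])
      have "monom (scale f w) (s + (k + (n + n')))
        = poly_scale scale (monom f s) (poly_scale scale u (poly_scale scale x' m - poly_scale scale x m'))"
        by (simp only: uw poly_scale_monom[OF M])
      also have "\<dots> = 0" using u(2) by (simp add: scale_right_diff_distrib mult_ac)
      finally have "scale f w = 0" by simp
      then have "w \<in> torsion scale I"
        using inj[of w] M.subspace_0[OF subspace_torsion[OF M, of I]] by simp
      then obtain e where e: "\<forall>b\<in>ideal_power I e. scale b w = 0"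
        by (auto simp: torsion_def annihilated_by_def)
      obtain h where h: "h \<in> I" "monom h 1 \<notin> y" using point_in_chart[OF p] by blast
      have he: "h ^ e \<in> ideal_power I e" by (rule power_in_ideal_power[OF h(1)])
      have "monom (h ^ e) e \<in> outside (rees_ring I) y"
        using chart_power_notin[OF p h] monom_rees_ring[OF he] by (auto simp: outside_def)
      then have "monom (h ^ e) e * u \<in> outside (rees_ring I) y"
        using outside_mult[OF p _ u(1)] by blast
      moreover have "poly_scale scale (monom (h ^ e) e * u)
          (poly_scale scale x' m - poly_scale scale x m') = 0"
      proof -
        have "poly_scale scale (monom (h ^ e) e * u) (poly_scale scale x' m - poly_scale scale x m')
          = poly_scale scale (monom (h ^ e) e) (monom w (k + (n + n')))"
          by (simp only: uw flip: scale_scale)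
        then show ?thesis using e he by (simp add: poly_scale_monom[OF M])
      qed
      ultimately have "loc_eq (poly_scale scale) (outside (rees_ring I) y) m x m' x'"
        unfolding loc_eq_def by blast
      then show ?thesis using m m' by (simp add: fr_eq_iff[OF p])
    qed
    moreover have "a \<in> extensional U" "a' \<in> extensional U"
      using a by (auto simp: associated_sheaf_def PiE_def)
    ultimately show "a = a'" by (rule extensionalityI[rotated -1])
  qed
  then show ?thesis
    unfolding Proj_regular_def regular_section_def blowup_sheaf_def twisting_sheaf_def by blast
qed

text \<open>
  The sections \<open>m / 1\<close> and \<open>0 / 1\<close> have the same product with \<open>\<sigma> = \<alpha>\<^sub>s(f t\<^sup>s)\<close>. Indeed, on the chart
  of \<open>h\<close> put \<open>r = f t\<^sup>s / (h t)\<^sup>s\<close> and \<open>\<tau> = (h t)\<^sup>s / 1\<close>. Then \<open>\<sigma> = r \<tau>\<close>, and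
  \<open>(m / 1) \<otimes> \<sigma> = r (m / 1) \<otimes> \<tau>\<close>, where \<open>r (m / 1) = 0\<close> because a power of \<open>h\<close> kills \<open>f m\<close>. By
  regularity \<open>m / 1 = 0\<close> at all points, in particular at those that come from primes of \<open>R\<close>.
\<close>

lemma inj_mod_torsion_if_regular:
  assumes M: "module scale" and f: "f \<in> ideal_power I s"
    and A: "finite A" "ideal.span A = I"
    and reg: "Proj_regular (rees_ring I) s (blowup_sheaf scale I) (alpha I s (monom f s))"
    and fm: "scale f m \<in> torsion scale I"
  shows "m \<in> torsion scale I"
proof -
  interpret M: module scale by fact
  interpret graded_module "rees_ring I" "poly_scale scale" "rees_module scale I"
    by (rule graded_module_rees[OF M])
  interpret L: graded_module "rees_ring I" "(*)" "\<lambda>n. rees_ring I (n + s)"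
    by (rule graded_module_twist)
  interpret R: graded_module "rees_ring I" "(*)" "rees_ring I"
    by (rule graded_module_ring)
  interpret T: tensor_data "Proj_topology (rees_ring I)" "Proj_structure_sheaf (rees_ring I)" sheaf L.sheaf
    by (rule tensor_data_Proj[OF graded_module_twist])
  let ?S = "rees_ring I"
  let ?X = "Proj_topology ?S" and ?\<sigma> = "alpha I s (monom f s)" and ?U = "Proj_points ?S"
  have U: "openin ?X ?U" using openin_topspace[of ?X] by (simp add: topspace_rees_Proj)
  define glob where "glob = (\<lambda>m::'b. \<lambda>p\<in>?U. fr p (monom m 0) 1)"
  have m0: "monom m 0 \<in> rees_module scale I 0" for m
  proof -
    have "scale 1 m \<in> ideal_times scale (ideal_power I 0) UNIV"
      unfolding ideal_times_def by (intro M.span_base CollectI exI[of _ 1] exI[of _ m]) simp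
    then show ?thesis by (auto simp: rees_module_def)
  qed
  have glob: "glob m \<in> sections sheaf ?U" for m
    unfolding glob_def
    by (rule const_section[OF U, where n = 0]) (auto intro: m0 one_rees_ring simp: one_notin_point)
  obtain k where k: "\<forall>b\<in>ideal_power I k. scale b (scale f m) = 0"
    using fm by (auto simp: torsion_def annihilated_by_def)
  have \<sigma>: "restrict ?\<sigma> ?U \<in> sections L.sheaf ?U"
    using restrict_section[OF U order_refl] alpha_global_section[OF f]
    by (simp add: twisting_sheaf_def)
  have "\<exists>V. openin ?X V \<and> y \<in> V \<and> V \<subseteq> ?U \<and>
      T.cls V (frag_of (restrict (glob m) V, restrict ?\<sigma> V))
      = T.cls V (frag_of (restrict (glob 0) V, restrict ?\<sigma> V))" if y: "y \<in> ?U" for y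
  proof -
    obtain h where h: "h \<in> I" "monom h 1 \<notin> y" using point_in_chart[OF y] by blast
    define V where "V = {p \<in> ?U. monom h 1 \<notin> p}"
    have VU: "V \<subseteq> ?U" by (auto simp: V_def)
    have hp: "monom (h ^ n) n \<in> ?S n" for n
      by (rule monom_rees_ring[OF power_in_ideal_power[OF h(1)]])
    have hV: "monom (h ^ n) n \<notin> p" if "p \<in> V" for n p
      using chart_power_notin[OF _ h(1), of p] that by (auto simp: V_def)
    have V: "openin ?X V" unfolding V_def using open_basic[OF hp[of 1]] by simp
    define r where "r = (\<lambda>p\<in>V. R.fr p (monom f s) (monom (h ^ s) s))"
    define \<tau> where "\<tau> = (\<lambda>p\<in>V. L.fr p (monom (h ^ s) s) 1)"
    have r: "r \<in> sections (Proj_structure_sheaf ?S) V"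
      unfolding r_def Proj_structure_sheaf_def
      by (rule const_section[OF V, where n = s]) (auto intro: monom_rees_ring f hp simp: hV)
    have \<tau>: "\<tau> \<in> sections L.sheaf V"
      unfolding \<tau>_def
      by (rule const_section[OF V, where n = 0]) (use hp one_rees_ring one_notin_point VU in auto)
    have hfr: "(monom f s, monom (h ^ s) s) \<in> R.hf p" if "p \<in> V" for p
      using monom_rees_ring[OF f] hp hV[OF that] by (auto simp: homogeneous_fractions_def)
    have hft: "(monom (h ^ s) s, 1) \<in> L.hf p" "(monom f s, 1) \<in> L.hf p" if "p \<in> V" for p
      using hp monom_rees_ring[OF f] one_rees_ring one_notin_point VU that
      by (auto simp: homogeneous_fractions_def intro!: exI[of _ 0])
    have hfm: "(monom m 0, 1) \<in> hf p" if "p \<in> V" for p m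
      using m0 one_rees_ring one_notin_point VU that
      by (auto simp: homogeneous_fractions_def intro!: exI[of _ 0])
    have "section_smult L.sheaf V r \<tau> = restrict ?\<sigma> V"
    proof
      fix p
      show "section_smult L.sheaf V r \<tau> p = restrict ?\<sigma> V p"
      proof (cases "p \<in> V")
        case True
        then have p: "p \<in> ?U" using VU by blast
        interpret loc: localization "(*)" "outside ?S p"
          by (rule localization_outside[OF module_mult p])
        have "L.fr p (monom f s * monom (h ^ s) s) (monom (h ^ s) s * 1) = L.fr p (monom f s) 1"
          using L.hf_smult[OF p hfr[OF True] hft(1)[OF True]] hft(2)[OF True]
          by (subst L.fr_eq_iff[OF p]) (auto intro!: loc.eqI1)
        then show ?thesis
          using True p L.stalk_smult_fr[OF p hfr[OF True] hft(1)[OF True]]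
          by (simp add: section_smult_def r_def \<tau>_def alpha_def)
      qed (simp add: section_smult_def)
    qed
    moreover have "section_smult sheaf V r (restrict (glob m) V)
      = section_smult sheaf V r (restrict (glob 0) V)"
    proof
      fix p
      show "section_smult sheaf V r (restrict (glob m) V) p
        = section_smult sheaf V r (restrict (glob 0) V) p"
      proof (cases "p \<in> V")
        case True
        then have p: "p \<in> ?U" using VU by blast
        have "monom (h ^ k) k \<in> outside ?S p"
          using hp hV[OF True] by (auto simp: outside_def)
        moreover have "scale (h ^ k) (scale f m) = 0"
          using k power_in_ideal_power[OF h(1)] by blast
        ultimately have "loc_eq (poly_scale scale) (outside ?S p)
            (poly_scale scale (monom f s) (monom m 0)) (monom (h ^ s) s * 1)
            (poly_scale scale (monom f s) (monom 0 0)) (monom (h ^ s) s * 1)"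
          unfolding loc_eq_def
          by (intro bexI[of _ "monom (h ^ k) k"])
            (simp_all add: poly_scale_monom[OF M] M.scale_left_commute[of "h ^ k"] del: M.scale_scale)
        then have "fr p (poly_scale scale (monom f s) (monom m 0)) (monom (h ^ s) s * 1)
            = fr p (poly_scale scale (monom f s) (monom 0 0)) (monom (h ^ s) s * 1)"
          by (rule iffD2[OF fr_eq_iff[OF p hf_smult[OF p hfr[OF True] hfm[OF True]]
                hf_smult[OF p hfr[OF True] hfm[OF True]]]])
        then show ?thesis
          using True p stalk_smult_fr[OF p hfr[OF True] hfm[OF True]]
          by (simp add: section_smult_def r_def glob_def del: monom_eq_0)
      qed (simp add: section_smult_def)
    qed
    ultimately have "T.cls V (frag_of (restrict (glob m) V, restrict ?\<sigma> V))
      = T.cls V (frag_of (restrict (glob 0) V, restrict ?\<sigma> V))"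
      using T.smult_balanced[OF V r restrict_section[OF V VU glob] \<tau>] by metis
    then show ?thesis using V y h(2) VU by (intro exI[of _ V]) (auto simp: V_def)
  qed
  then have "mult_section ?X (Proj_structure_sheaf ?S) sheaf L.sheaf ?\<sigma> ?U (glob m)
    = mult_section ?X (Proj_structure_sheaf ?S) sheaf L.sheaf ?\<sigma> ?U (glob 0)"
    unfolding T.mult_section_eq_iff[OF U glob glob \<sigma>] by blast
  then have glob_eq: "glob m = glob 0"
    using reg U glob
    unfolding Proj_regular_def regular_section_def blowup_sheaf_def twisting_sheaf_def
    by (meson inj_onD)
  have "\<exists>n. scale (h ^ n) m = 0" if h: "h \<in> I" for h
  proof (rule ccontr)
    assume nz: "\<nexists>n. scale (h ^ n) m = 0"
    \<comment> \<open>A prime over the annihilator of \<open>m\<close> without \<open>h\<close> gives a point where \<open>m / 1\<close> survives.\<close>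
    let ?J = "{c. scale c m = 0}"
    have "is_ideal ?J"
      by (rule ideal.subspaceI)
        (auto simp: M.scale_left_distrib simp flip: M.scale_scale)
    moreover have "h ^ n \<notin> ?J" for n using nz by simp
    ultimately have "\<exists>q. is_ideal q \<and> ?J \<subseteq> q \<and> (\<forall>n. h ^ n \<notin> q)
        \<and> (\<forall>a b. a * b \<in> q \<longrightarrow> a \<in> q \<or> b \<in> q)"
      by (rule prime_avoiding_powers)
    then obtain q where q: "is_ideal q" "?J \<subseteq> q" "\<forall>n. h ^ n \<notin> q"
      "\<forall>a b. a * b \<in> q \<longrightarrow> a \<in> q \<or> b \<in> q"
      by (elim exE conjE)
    define y where "y = {p \<in> graded_total ?S. \<forall>i. coeff p i \<in> q}"
    have y: "y \<in> ?U"
      unfolding y_def using q(3)[THEN spec, of 0] q(3)[THEN spec, of 1] q(4) h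
      by (intro point_of_prime[OF q(1), of h]) simp_all
    have hfm: "(monom m 0, 1) \<in> hf y" for m
      using m0 one_rees_ring one_notin_point y
      by (auto simp: homogeneous_fractions_def intro!: exI[of _ 0])
    have "fr y (monom m 0) 1 = fr y (monom 0 0) 1"
      using fun_cong[OF glob_eq, of y] y by (simp add: glob_def)
    then obtain u where u: "u \<in> outside ?S y" "poly_scale scale u (monom m 0) = 0"
      by (subst (asm) fr_eq_iff[OF y hfm hfm]) (auto simp: loc_eq_def)
    then obtain c n where c: "u = monom c n" "c \<in> ideal_power I n" "u \<notin> y"
      by (auto simp: outside_def rees_ring_def)
    have "scale c m = 0" using u(2) by (simp add: c(1) poly_scale_monom[OF M])
    then have "c \<in> q" using q(2) by blast
    then have "u \<in> y"
      using c(2) ideal.subspace_0[OF q(1)] zero_ideal_power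
      by (auto simp: y_def c(1) graded_total_rees)
    then show False using c(3) by blast
  qed
  then have "\<forall>h\<in>A. \<exists>n. scale (h ^ n) m = 0" using A(2) ideal.span_base by blast
  then show ?thesis using torsion_spanI[OF M A(1)] A(2) by simp
qed

theorem lemma5p1:
  fixes scale :: "'a::comm_ring_1 \<Rightarrow> 'b::ab_group_add \<Rightarrow> 'b"
    and I :: "'a set" and f :: 'a and s :: nat
  assumes "noetherian_type TYPE('a)"
    and "is_ideal I"
    and "module scale"
    and "finitely_generated scale"
    and "f \<in> ideal_power I s - ideal_power I (s + 1)"
  shows "inj_on (quotient_mult scale (torsion scale I) f) (UNIV // mod_rel (torsion scale I))
    \<longleftrightarrow> Proj_regular (rees_ring I) s (blowup_sheaf scale I) (alpha I s (monom f s))"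
proof -
  have f: "f \<in> ideal_power I s" using assms(5) by blast
  obtain A where A: "finite A" "ideal.span A = I"
    using assms(1,2) unfolding noetherian_type_def by blast
  show ?thesis
    unfolding inj_on_quotient_mult_iff[OF assms(3) subspace_torsion[OF assms(3)]]
    using regular_if_inj_mod_torsion[OF assms(3) f] inj_mod_torsion_if_regular[OF assms(3) f A]
    by blast
qed

end
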